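(* For every real number $p>2$ there exists an integer $d\ge 2$ such that the channel $\Lambda_d$ determined by the antisymmetric subspace of $\mathbb{C}^d\otimes\mathbb{C}^d$ (with input dimension $\binom{d}{2}$ and output dimension $d$) violates additivity of the minimum output Rényi $p$-entropy: $$S_p^{\min}(\Lambda_d\otimes\Lambda_d)<2\,S_p^{\min}(\Lambda_d).$$
   Context: For a density matrix $\rho$ and $p>0$, $p\ne 1$, the quantum Rényi $p$-entropy is $S_p(\rho)=\frac{1}{1-p}\log \mathrm{Tr}\,\rho^p$, with logarithm to base $2$. For a quantum channel (completely positive trace-preserving map) $\Lambda$ between matrix algebras, the minimum output Rényi entropy is $S_p^{\min}(\Lambda)=\min_{\psi}S_p(\Lambda(|\psi\rangle\langle\psi|))$, the minimum being over all unit vectors $\psi$ in the input Hilbert space; for $\Lambda\otimes\Lambda$ the minimum is over all unit vectors (including entangled ones) in the tensor product of the two input spaces. The antisymmetric subspace of $\mathbb{C}^d\otimes\mathbb{C}^d$ is $\mathcal{A}_d=\{\psi : V\psi=-\psi\}$, where $V$ is the swap operator, $V(x\otimes y)=y\otimes x$; it has dimension $\binom{d}{2}$. The channel $\Lambda_d$ takes operators on $\mathcal{A}_d$ to operators on $\mathbb{C}^d$ by $\Lambda_d(\rho)=\mathrm{Tr}_A(W\rho W^\dagger)$, where $W:\mathcal{A}_d\hookrightarrow\mathcal{H}_A\otimes\mathcal{H}_B=\mathbb{C}^d\otimes\mathbb{C}^d$ is the inclusion isometry and $\mathrm{Tr}_A$ is the partial trace over the first factor. Equivalently, $S_p^{\min}(\Lambda_d)$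 is the minimum of $S_p(\rho_B)$ over unit vectors in $\mathcal{A}_d$, and $S_p^{\min}(\Lambda_d\otimes\Lambda_d)$ is the minimum of $S_p(\rho_{BB'})$ over unit vectors in $\mathcal{A}_d\otimes\mathcal{A}_d\subset(\mathcal{H}_A\otimes\mathcal{H}_B)\otimes(\mathcal{H}_{A'}\otimes\mathcal{H}_{B'})$, where $\rho_B,\rho_{BB'}$ are the reduced density matrices. *)

theory Defs
  imports "Jordan_Normal_Form.Schur_Decomposition" Complex_Main
begin

text \<open>
  The Hilbert space \<open>C^n\<close> is \<open>carrier_vec n\<close>, and \<open>C^a \<otimes> C^b\<close> is \<open>carrier_vec (a * b)\<close>, with the basis
  vector \<open>e_i \<otimes> e_k\<close> at index \<open>i * b + k\<close>.
\<close>

subsection \<open>Real powers of positive semidefinite matrices and the Renyi entropy\<close>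

text \<open>
  Functional calculus: \<open>spectral_powr A p B\<close> says \<open>A = U diag(f) U^*\<close> and \<open>B = U diag(f^p) U^*\<close> for some
  unitary \<open>U\<close> and nonnegative eigenvalues \<open>f\<close>. As \<open>0 powr p = 0\<close>, a zero eigenvalue contributes
  nothing, as it should for \<open>p > 0\<close>.
\<close>

definition spectral_powr :: "complex mat \<Rightarrow> real \<Rightarrow> complex mat \<Rightarrow> bool" where
  "spectral_powr A p B \<longleftrightarrow>
     (\<exists>U f. U \<in> carrier_mat (dim_row A) (dim_row A) \<and>
        mat_adjoint U * U = 1\<^sub>m (dim_row A) \<and> U * mat_adjoint U = 1\<^sub>m (dim_row A) \<and>
        (\<forall>i<dim_row A. (0::real) \<le> f i) \<and>
        A = U * mat_diag (dim_row A) (\<lambda>i. complex_of_real (f i)) * mat_adjoint U \<and>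
        B = U * mat_diag (dim_row A) (\<lambda>i. complex_of_real (f i powr p)) * mat_adjoint U)"

text \<open>
  For positive semidefinite \<open>A\<close> the matrix \<open>B\<close> exists and does not depend on the chosen diagonalisation.
\<close>

definition psd_powr :: "complex mat \<Rightarrow> real \<Rightarrow> complex mat" where
  "psd_powr A p = (SOME B. spectral_powr A p B)"

definition mat_trace :: "complex mat \<Rightarrow> complex" where
  "mat_trace A = (\<Sum>i<dim_row A. A $$ (i, i))"

definition renyi_entropy :: "real \<Rightarrow> complex mat \<Rightarrow> real" where
  "renyi_entropy p \<rho> = 1 / (1 - p) * log 2 (Re (mat_trace (psd_powr \<rho> p)))"

subsection \<open>Channels, tensor products and minimum output entropy\<close>

definition ket_bra :: "complex vec \<Rightarrow> complex mat" where
  "ket_bra \<psi> = Matrix.mat (dim_vec \<psi>) (dim_vec \<psi>) (\<lambda>(i, j). \<psi> $ i * cnj (\<psi> $ j))"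

text \<open>
  \<open>\<Lambda>\<close> maps \<open>n \<times> n\<close> matrices to square matrices. The minimum over the unit sphere is written as an infimum;
  for a channel and \<open>n \<ge> 1\<close> it is attained, by compactness and continuity.
\<close>

definition min_output_renyi :: "real \<Rightarrow> nat \<Rightarrow> (complex mat \<Rightarrow> complex mat) \<Rightarrow> real" where
  "min_output_renyi p n \<Lambda> =
     Inf {renyi_entropy p (\<Lambda> (ket_bra \<psi>)) | \<psi>. \<psi> \<in> carrier_vec n \<and> \<psi> \<bullet>c \<psi> = 1}"

definition matrix_unit :: "nat \<Rightarrow> nat \<Rightarrow> nat \<Rightarrow> complex mat" where
  "matrix_unit n i j = Matrix.mat n n (\<lambda>(r, s). if r = i \<and> s = j then 1 else 0)"

definition kronecker :: "complex mat \<Rightarrow> complex mat \<Rightarrow> complex mat" where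
  "kronecker A B = Matrix.mat (dim_row A * dim_row B) (dim_col A * dim_col B)
     (\<lambda>(r, s). A $$ (r div dim_row B, s div dim_col B) * B $$ (r mod dim_row B, s mod dim_col B))"

text \<open>
  The tensor product of linear maps \<open>\<Phi> : M_n \<rightarrow> M_n'\<close> and \<open>\<Psi> : M_m \<rightarrow> M_m'\<close>: the linear map on \<open>M_(n m)\<close>
  sending \<open>E_ij \<otimes> E_kl\<close> to \<open>\<Phi>(E_ij) \<otimes> \<Psi>(E_kl)\<close>. In the sum, \<open>X $$ (i * m + k, j * m + l)\<close> is the
  coefficient of \<open>E_ij \<otimes> E_kl\<close> in \<open>X\<close>.
\<close>

definition tensor_map :: "nat \<Rightarrow> nat \<Rightarrow> nat \<Rightarrow> nat \<Rightarrow>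
    (complex mat \<Rightarrow> complex mat) \<Rightarrow> (complex mat \<Rightarrow> complex mat) \<Rightarrow> complex mat \<Rightarrow> complex mat" where
  "tensor_map n n' m m' \<Phi> \<Psi> X = Matrix.mat (n' * m') (n' * m') (\<lambda>(r, s).
     \<Sum>i<n. \<Sum>j<n. \<Sum>k<m. \<Sum>l<m. X $$ (i * m + k, j * m + l) *
       kronecker (\<Phi> (matrix_unit n i j)) (\<Psi> (matrix_unit m k l)) $$ (r, s))"

definition partial_trace_fst :: "nat \<Rightarrow> nat \<Rightarrow> complex mat \<Rightarrow> complex mat" where
  "partial_trace_fst a b X =
     Matrix.mat b b (\<lambda>(k, l). \<Sum>i<a. X $$ (i * b + k, i * b + l))"

subsection \<open>The antisymmetric subspace and its channel\<close>

definition swap_op :: "nat \<Rightarrow> complex mat" where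
  "swap_op d = Matrix.mat (d * d) (d * d)
     (\<lambda>(r, s). if r div d = s mod d \<and> r mod d = s div d then 1 else 0)"

definition antisym_space :: "nat \<Rightarrow> complex vec set" where
  "antisym_space d = {\<psi> \<in> carrier_vec (d * d). swap_op d *\<^sub>v \<psi> = - \<psi>}"

definition antisym_pairs :: "nat \<Rightarrow> (nat \<times> nat) list" where
  "antisym_pairs d = [(i, j). j \<leftarrow> [0..<d], i \<leftarrow> [0..<j]]"

text \<open>
  The inclusion \<open>W\<close> of the antisymmetric subspace, written in the orthonormal basis
  \<open>(e_i \<otimes> e_j - e_j \<otimes> e_i) / sqrt 2\<close> (\<open>i < j\<close>), which identifies the subspace with \<open>C^(d choose 2)\<close>.
  The lemmas \<open>antisym_isometry_isometry\<close> and \<open>antisym_isometry_range\<close> below confirm that \<open>W^* W = 1\<close> and that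
  the range of \<open>W\<close> is the antisymmetric subspace.
\<close>

definition antisym_isometry :: "nat \<Rightarrow> complex mat" where
  "antisym_isometry d = Matrix.mat (d * d) (d choose 2) (\<lambda>(r, c).
     let (i, j) = antisym_pairs d ! c in
       if r = i * d + j then complex_of_real (1 / sqrt 2)
       else if r = j * d + i then - complex_of_real (1 / sqrt 2)
       else 0)"

definition antisym_channel :: "nat \<Rightarrow> complex mat \<Rightarrow> complex mat" where
  "antisym_channel d \<rho> =
     partial_trace_fst d d (antisym_isometry d * \<rho> * mat_adjoint (antisym_isometry d))"

subsection \<open>The columns of the isometry form an orthonormal basis of the antisymmetric subspace\<close>

lemma antisym_pairs_Suc:
  "antisym_pairs (Suc d) = antisym_pairs d @ map (\<lambda>i. (i, d)) [0..<d]"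
  by (simp add: antisym_pairs_def)

lemma length_antisym_pairs [simp]: "length (antisym_pairs d) = d choose 2"
proof (induction d)
  case 0
  show ?case by (simp add: antisym_pairs_def binomial_eq_0)
next
  case (Suc d)
  have "Suc d choose 2 = d + (d choose 2)"
    by (metis Suc_1 binomial_Suc_Suc choose_one One_nat_def)
  then show ?case
    by (simp only: antisym_pairs_Suc length_append length_map length_upt Suc.IH)
qed

lemma set_antisym_pairs: "set (antisym_pairs d) = {(i, j). i < j \<and> j < d}"
  by (auto simp: antisym_pairs_def)

lemma distinct_antisym_pairs: "distinct (antisym_pairs d)"
proof (induction d)
  case 0
  show ?case by (simp add: antisym_pairs_def)
next
  case (Suc d)
  then show ?case
    by (auto simp: antisym_pairs_Suc set_antisym_pairs distinct_map inj_on_def)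
qed

lemma antisym_pairs_nth:
  assumes "c < d choose 2"
  obtains i j where "antisym_pairs d ! c = (i, j)" "i < j" "j < d"
proof -
  have "antisym_pairs d ! c \<in> set (antisym_pairs d)"
    using assms by (intro nth_mem) simp
  then show thesis
    using that by (auto simp: set_antisym_pairs)
qed

lemma antisym_pairs_less:
  assumes "c < d choose 2"
  shows "fst (antisym_pairs d ! c) < snd (antisym_pairs d ! c)"
  by (rule antisym_pairs_nth[OF assms]) simp

lemma pair_index_less: "i < d \<Longrightarrow> j < d \<Longrightarrow> i * d + j < d * (d::nat)"
  by (metis add_less_cancel_left less_le_trans mult.commute mult_Suc_right mult_le_mono2 Suc_leI add.commute)

lemma pair_index_eq:
  assumes "j < d" "j' < (d::nat)"
  shows "i * d + j = i' * d + j' \<longleftrightarrow> i = i' \<and> j = j'"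
proof
  assume h: "i * d + j = i' * d + j'"
  have "(i * d + j) div d = i" "(i * d + j) mod d = j"
    "(i' * d + j') div d = i'" "(i' * d + j') mod d = j'"
    using assms by auto
  with h show "i = i' \<and> j = j'" by metis
qed auto

lemma half_sq: "complex_of_real (1 / sqrt 2) * complex_of_real (1 / sqrt 2) = 1 / 2"
proof -
  have "(1 / sqrt 2) * (1 / sqrt 2) = (1 / 2 :: real)" by simp
  then show ?thesis by (metis of_real_mult of_real_divide of_real_1 of_real_numeral)
qed

lemma antisym_isometry_carrier [simp]:
  "antisym_isometry d \<in> carrier_mat (d * d) (d choose 2)"
  by (simp add: antisym_isometry_def)

lemma antisym_isometry_isometry:
  "mat_adjoint (antisym_isometry d) * antisym_isometry d = 1\<^sub>m (d choose 2)"
proof (rule eq_matI)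
  let ?W = "antisym_isometry d"
  define s where "s = complex_of_real (1 / sqrt 2)"
  have s: "s * s = 1 / 2" "cnj s = s"
    using half_sq by (simp_all add: s_def)
  fix c c' assume "c < dim_row (1\<^sub>m (d choose 2))" "c' < dim_col (1\<^sub>m (d choose 2))"
  then have c: "c < d choose 2" "c' < d choose 2" by auto
  obtain i j where ij: "antisym_pairs d ! c = (i, j)" "i < j" "j < d"
    using antisym_pairs_nth[OF c(1)] .
  obtain i' j' where ij': "antisym_pairs d ! c' = (i', j')" "i' < j'" "j' < d"
    using antisym_pairs_nth[OF c(2)] .
  have cc: "c = c' \<longleftrightarrow> (i = i' \<and> j = j')"
    using nth_eq_iff_index_eq[OF distinct_antisym_pairs, of c d c'] c ij ij' by auto
  have W: "?W $$ (r, c) = (if r = i * d + j then s else if r = j * d + i then - s else 0)"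
    "?W $$ (r, c') = (if r = i' * d + j' then s else if r = j' * d + i' then - s else 0)"
    if "r < d * d" for r
    using that c ij ij' by (auto simp: antisym_isometry_def s_def)
  have "(mat_adjoint ?W * ?W) $$ (c, c') = (\<Sum>r<d * d. cnj (?W $$ (r, c)) * ?W $$ (r, c'))"
    using c by (simp add: mat_adjoint_def antisym_isometry_def scalar_prod_def
        atLeast0LessThan mat_of_rows_def)
  also have "\<dots> = (\<Sum>r<d * d. (if r = i * d + j then s * ?W $$ (i * d + j, c') else 0)
      + (if r = j * d + i then - s * ?W $$ (j * d + i, c') else 0))"
    by (intro sum.cong) (use ij in \<open>auto simp: W(1) s pair_index_eq\<close>)
  also have "\<dots> = s * ?W $$ (i * d + j, c') - s * ?W $$ (j * d + i, c')"
    using ij by (simp add: sum.distrib pair_index_less)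
  also have "\<dots> = (if c = c' then 1 else 0)"
    using ij ij' by (auto simp: W(2) pair_index_less pair_index_eq cc s(1))
  finally show "(mat_adjoint ?W * ?W) $$ (c, c') = 1\<^sub>m (d choose 2) $$ (c, c')"
    using c by simp
qed (auto simp: mat_adjoint_def antisym_isometry_def)

lemma antisym_space_iff:
  "\<psi> \<in> antisym_space d \<longleftrightarrow> \<psi> \<in> carrier_vec (d * d) \<and>
     (\<forall>a<d. \<forall>b<d. \<psi> $ (b * d + a) = - \<psi> $ (a * d + b))"
proof (cases "\<psi> \<in> carrier_vec (d * d)")
  case True
  have sw: "(swap_op d *\<^sub>v \<psi>) $ (a * d + b) = \<psi> $ (b * d + a)" if ab: "a < d" "b < d" for a b
  proof -
    have "(swap_op d *\<^sub>v \<psi>) $ (a * d + b) = (\<Sum>s<d * d. swap_op d $$ (a * d + b, s) * \<psi> $ s)"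
      using True ab by (simp add: swap_op_def scalar_prod_def atLeast0LessThan pair_index_less)
    also have "\<dots> = (\<Sum>s<d * d. if s = b * d + a then \<psi> $ s else 0)"
    proof (intro sum.cong refl)
      fix s assume s: "s \<in> {..<d * d}"
      have "(s mod d = a \<and> s div d = b) \<longleftrightarrow> s = b * d + a"
        using ab by (auto simp: mult.commute)
      then show "swap_op d $$ (a * d + b, s) * \<psi> $ s = (if s = b * d + a then \<psi> $ s else 0)"
        using s ab by (auto simp: swap_op_def pair_index_less)
    qed
    also have "\<dots> = \<psi> $ (b * d + a)"
      using ab by (simp add: pair_index_less)
    finally show ?thesis .
  qed
  have "swap_op d *\<^sub>v \<psi> = - \<psi> \<longleftrightarrow> (\<forall>r<d * d. (swap_op d *\<^sub>v \<psi>) $ r = - \<psi> $ r)"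
    using True by (auto simp: vec_eq_iff swap_op_def)
  also have "\<dots> \<longleftrightarrow> (\<forall>a<d. \<forall>b<d. \<psi> $ (b * d + a) = - \<psi> $ (a * d + b))"
  proof (intro iffI allI impI)
    fix a b assume "\<forall>r<d * d. (swap_op d *\<^sub>v \<psi>) $ r = - \<psi> $ r" "a < d" "b < d"
    then show "\<psi> $ (b * d + a) = - \<psi> $ (a * d + b)"
      using sw pair_index_less by metis
  next
    fix r assume h: "\<forall>a<d. \<forall>b<d. \<psi> $ (b * d + a) = - \<psi> $ (a * d + b)" and r: "r < d * d"
    have "d > 0" using r by (cases d) auto
    then have "r div d < d" "r mod d < d"
      using r by (auto simp: less_mult_imp_div_less)
    then show "(swap_op d *\<^sub>v \<psi>) $ r = - \<psi> $ r"
      using h sw[of "r div d" "r mod d"] by simp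
  qed
  finally show ?thesis using True by (simp add: antisym_space_def)
qed (simp add: antisym_space_def)

lemma antisym_isometry_mult:
  assumes "x \<in> carrier_vec (d choose 2)" "r < d * d"
  shows "(antisym_isometry d *\<^sub>v x) $ r = (\<Sum>c<d choose 2. antisym_isometry d $$ (r, c) * x $ c)"
  using assms by (simp add: antisym_isometry_def scalar_prod_def atLeast0LessThan)

lemma antisym_isometry_entry:
  assumes "a < d" "b < d" "c < d choose 2"
  shows "antisym_isometry d $$ (a * d + b, c) =
    (if antisym_pairs d ! c = (a, b) then complex_of_real (1 / sqrt 2)
     else if antisym_pairs d ! c = (b, a) then - complex_of_real (1 / sqrt 2) else 0)"
proof -
  obtain i j where ij: "antisym_pairs d ! c = (i, j)" "i < j" "j < d"
    using antisym_pairs_nth[OF assms(3)] .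
  then show ?thesis
    using assms by (auto simp: antisym_isometry_def pair_index_less pair_index_eq)
qed

lemma antisym_isometry_range:
  "(*\<^sub>v) (antisym_isometry d) ` carrier_vec (d choose 2) = antisym_space d"
proof (intro equalityI subsetI)
  fix y assume "y \<in> (*\<^sub>v) (antisym_isometry d) ` carrier_vec (d choose 2)"
  then obtain x where x: "x \<in> carrier_vec (d choose 2)" "y = antisym_isometry d *\<^sub>v x" by auto
  have "y $ (b * d + a) = - y $ (a * d + b)" if ab: "a < d" "b < d" for a b
  proof -
    have "antisym_isometry d $$ (b * d + a, c) = - antisym_isometry d $$ (a * d + b, c)"
      if c: "c < d choose 2" for c
    proof -
      obtain i j where ij: "antisym_pairs d ! c = (i, j)" "i < j" "j < d"
        using antisym_pairs_nth[OF c] .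
      show ?thesis
        unfolding antisym_isometry_entry[OF ab(2) ab(1) c] antisym_isometry_entry[OF ab c] ij(1)
        using ij(2) by (simp del: of_real_divide)
    qed
    then show ?thesis
      unfolding x(2) antisym_isometry_mult[OF x(1) pair_index_less[OF ab]]
        antisym_isometry_mult[OF x(1) pair_index_less[OF ab(2) ab(1)]] sum_negf[symmetric]
      by (intro sum.cong) simp_all
  qed
  moreover have "y \<in> carrier_vec (d * d)"
    unfolding x(2) by (rule mult_mat_vec_carrier[OF antisym_isometry_carrier x(1)])
  ultimately show "y \<in> antisym_space d"
    unfolding antisym_space_iff by blast
next
  fix y assume y: "y \<in> antisym_space d"
  let ?s = "complex_of_real (1 / sqrt 2)" and ?p = "antisym_pairs d"
  define x where "x = Matrix.vec (d choose 2) (\<lambda>c. y $ (fst (?p ! c) * d + snd (?p ! c)) / ?s)"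
  have x: "x \<in> carrier_vec (d choose 2)" by (simp add: x_def)
  have anti: "y $ (b * d + a) = - y $ (a * d + b)" if "a < d" "b < d" for a b
    using y that unfolding antisym_space_iff by blast
  have yc: "y \<in> carrier_vec (d * d)"
    using y unfolding antisym_space_def by blast
  have lt: "(antisym_isometry d *\<^sub>v x) $ (a * d + b) = y $ (a * d + b) \<and>
      (antisym_isometry d *\<^sub>v x) $ (b * d + a) = - y $ (a * d + b)" if ab: "a < b" "b < d" for a b
  proof -
    have "(a, b) \<in> set ?p" using ab by (simp add: set_antisym_pairs)
    then obtain k where k: "k < d choose 2" "?p ! k = (a, b)"
      by (metis in_set_conv_nth length_antisym_pairs)
    have uniq: "?p ! c = (a, b) \<longleftrightarrow> c = k" if "c < d choose 2" for c
      using nth_eq_iff_index_eq[OF distinct_antisym_pairs, of c d k] that k by auto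
    have no: "?p ! c \<noteq> (b, a)" if c: "c < d choose 2" for c
      using antisym_pairs_less[OF c] ab by auto
    have "a < d" using ab by simp
    have "(antisym_isometry d *\<^sub>v x) $ (a * d + b) = (\<Sum>c<d choose 2. if c = k then ?s * x $ k else 0)"
      unfolding antisym_isometry_mult[OF x pair_index_less[OF \<open>a < d\<close> \<open>b < d\<close>]]
      using ab \<open>a < d\<close> by (intro sum.cong) (auto simp: antisym_isometry_entry uniq no)
    moreover have "(antisym_isometry d *\<^sub>v x) $ (b * d + a) = (\<Sum>c<d choose 2. if c = k then - ?s * x $ k else 0)"
      unfolding antisym_isometry_mult[OF x pair_index_less[OF \<open>b < d\<close> \<open>a < d\<close>]]
      using ab \<open>a < d\<close> by (intro sum.cong) (auto simp: antisym_isometry_entry uniq no)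
    moreover have "?s * x $ k = y $ (a * d + b)"
      using k by (simp add: x_def)
    ultimately show ?thesis using k by simp
  qed
  have diag: "y $ (a * d + a) = 0" if "a < d" for a
  proof -
    have "y $ (a * d + a) + y $ (a * d + a) = 0"
      using anti[OF that that] unfolding eq_neg_iff_add_eq_0 .
    then show ?thesis by (simp flip: mult_2)
  qed
  have Wdiag: "(antisym_isometry d *\<^sub>v x) $ (a * d + a) = 0" if a: "a < d" for a
  proof -
    have "?p ! c \<noteq> (a, a)" if c: "c < d choose 2" for c
      using antisym_pairs_less[OF c] by auto
    then show ?thesis
      unfolding antisym_isometry_mult[OF x pair_index_less[OF a a]]
      using a by (intro sum.neutral) (auto simp: antisym_isometry_entry)
  qed
  have eq: "(antisym_isometry d *\<^sub>v x) $ (a * d + b) = y $ (a * d + b)" if "a < d" "b < d" for a b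
  proof (cases a b rule: linorder_cases)
    case less
    then show ?thesis using lt[of a b] that by blast
  next
    case equal
    then show ?thesis using diag[of a] Wdiag[of a] that by metis
  next
    case greater
    then show ?thesis using lt[of b a] anti[of b a] that by metis
  qed
  have "antisym_isometry d *\<^sub>v x = y"
  proof (rule eq_vecI)
    fix r assume "r < dim_vec y"
    then have r: "r < d * d" using yc by simp
    then have "d > 0" by (cases d) auto
    then have "r div d < d" "r mod d < d"
      using r by (auto simp: less_mult_imp_div_less)
    then show "(antisym_isometry d *\<^sub>v x) $ r = y $ r"
      using eq[of "r div d" "r mod d"] by simp
  qed (use yc in \<open>simp add: antisym_isometry_def\<close>)
  then show "y \<in> (*\<^sub>v) (antisym_isometry d) ` carrier_vec (d choose 2)"
    using x by blast
qed

end

theory Submission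
  imports Defs "Jordan_Normal_Form.Spectral_Radius"
begin

text \<open>
  A vector in the antisymmetric subspace is an antisymmetric matrix, whose singular values come in equal pairs;
  hence every output of \<open>\<Lambda>\<^sub>d\<close> on a pure state has all eigenvalues at most \<open>1 / 2\<close>, its \<open>p\<close>-th moment is at most
  \<open>2 powr (1 - p)\<close>, and its entropy is at least \<open>1\<close>. For \<open>\<Lambda>\<^sub>d \<otimes> \<Lambda>\<^sub>d\<close>, the maximally entangled input yields an output
  with an eigenvalue \<open>(1 - 1 / d) / 2\<close>. For \<open>p > 2\<close> and large \<open>d\<close> the \<open>p\<close>-th power of this single eigenvalue
  exceeds \<open>4 powr (1 - p)\<close>, so the entropy drops below \<open>2\<close>.
\<close>

subsection \<open>Unitary diagonalisation of Hermitian matrices\<close>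

text \<open>The entropy rests on a chosen diagonalisation and the minimum on a real
  \<open>Inf\<close>; both shape the proof. On a pure input the output of one copy or of two is a
  sum of rank-one terms, one for each basis state of the traced-out space. A single spectral lemma
  for such sums therefore serves both sides: it expresses eigenvalues as sums of squared moduli,
  gives their total and the entropy in terms of them, and finds the eigenvalue of any given
  eigenvector. The large eigenvalue arises as follows: \<open>W \<otimes> W\<close> turns the
  maximally entangled input into the vectorised projection (1 - V) / 2, with V the swap. The
  identity part of this vector is a product of maximally entangled vectors on AA' and BB', and its
  weight is about 1/2. The threshold for p comes from comparing 2 powr (-p), the limit of the p-th
  power of that eigenvalue, with 4 powr (1 - p), the square of the one-copy bound: the former is
  larger exactly when p > 2. As 1 / (1 - p) is negative, large moments mean small entropy.\<close>

lemma mat_adjoint_carrier [simp]: "A \<in> carrier_mat m n \<Longrightarrow> mat_adjoint A \<in> carrier_mat n m"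
  by (auto simp: mat_adjoint_def)

lemma mat_adjoint_dim [simp]:
  "dim_row (mat_adjoint A) = dim_col A" "dim_col (mat_adjoint A) = dim_row A"
  by (auto simp: mat_adjoint_def)

lemma mat_adjoint_index [simp]:
  "i < dim_col A \<Longrightarrow> j < dim_row A \<Longrightarrow> mat_adjoint A $$ (i, j) = conjugate (A $$ (j, i))"
  by (simp add: mat_adjoint_def mat_of_rows_def)

lemma mult_mat_index_sum:
  assumes "A \<in> carrier_mat m n" "B \<in> carrier_mat n l" "i < m" "j < l"
  shows "(A * B) $$ (i, j) = (\<Sum>k<n. A $$ (i, k) * B $$ (k, j))"
  using assms by (auto simp: scalar_prod_def atLeast0LessThan)

lemma mult_mat_vec_index_sum:
  assumes "A \<in> carrier_mat m n" "v \<in> carrier_vec n" "i < m"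
  shows "(A *\<^sub>v v) $ i = (\<Sum>k<n. A $$ (i, k) * v $ k)"
  using assms by (auto simp: scalar_prod_def atLeast0LessThan)

lemma mat_adjoint_mult:
  fixes A :: "complex mat"
  assumes A: "A \<in> carrier_mat m n" and B: "B \<in> carrier_mat n l"
  shows "mat_adjoint (A * B) = mat_adjoint B * mat_adjoint A"
proof (rule eq_matI)
  fix i j assume "i < dim_row (mat_adjoint B * mat_adjoint A)" "j < dim_col (mat_adjoint B * mat_adjoint A)"
  then have ij: "i < l" "j < m" using A B by auto
  then show "mat_adjoint (A * B) $$ (i, j) = (mat_adjoint B * mat_adjoint A) $$ (i, j)"
    using A B by (simp del: index_mult_mat(1) add: mult_mat_index_sum[OF A B] carrier_matD[OF A] carrier_matD[OF B]
        mult_mat_index_sum[OF mat_adjoint_carrier[OF B] mat_adjoint_carrier[OF A]] mult.commute)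
qed (use A B in auto)

lemma mat_adjoint_adjoint [simp]: "mat_adjoint (mat_adjoint (A :: complex mat)) = A"
  by (rule eq_matI) auto

text \<open>Completing \<open>v\<close> to a basis and orthogonalising by Gram-Schmidt leaves the
  first vector unchanged. The result is orthogonal but not normalised, so each column is divided by
  its length \<open>r\<close>, which is why \<open>v\<close> survives only up to the scalar
  \<open>c\<close>.\<close>

lemma exists_unitary_first_column:
  fixes v :: "complex vec"
  assumes v: "v \<in> carrier_vec n" "v \<noteq> 0\<^sub>v n"
  obtains U c where "U \<in> carrier_mat n n" "mat_adjoint U * U = 1\<^sub>m n" "col U 0 = c \<cdot>\<^sub>v v"
proof -
  interpret cof_vec_space n "TYPE(complex)" .
  note bc = basis_completion[OF v]
  define ws where "ws = gram_schmidt n (basis_completion v)"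
  note gs = gram_schmidt_result[OF bc(2,4,5) ws_def]
  have n0: "n > 0" using v by (cases n) auto
  have len: "length ws = n" using gs(4) bc(6) by simp
  have hd: "ws ! 0 = v"
  proof -
    obtain vs where b: "basis_completion v = v # vs"
      using bc(6,7) n0 by (cases "basis_completion v") auto
    have "hd ws = v" unfolding ws_def b using gram_schmidt_hd[OF v(1)] by simp
    then show ?thesis using len n0 by (cases ws) auto
  qed
  have car: "ws ! i \<in> carrier_vec n" if "i < n" for i using gs(3) that len by auto
  define r where "r i = sqrt (Re (ws ! i \<bullet>c ws ! i))" for i
  define U where "U = Matrix.mat n n (\<lambda>(i, j). ws ! j $ i / complex_of_real (r j))"
  have U: "U \<in> carrier_mat n n" by (simp add: U_def)
  have sp: "ws ! j \<bullet>c ws ! i = (\<Sum>k<n. ws ! j $ k * cnj (ws ! i $ k))" if "i < n" "j < n" for i j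
    using car[OF that(1)] car[OF that(2)] by (simp add: scalar_prod_def atLeast0LessThan)
  have rr: "complex_of_real (r i) * complex_of_real (r i) = ws ! i \<bullet>c ws ! i" "r i \<noteq> 0" if i: "i < n" for i
  proof -
    have e: "ws ! i \<bullet>c ws ! i = complex_of_real (\<Sum>k<n. (cmod (ws ! i $ k))\<^sup>2)"
      unfolding sp[OF i i] by (simp only: complex_norm_square of_real_sum)
    then have ge: "Re (ws ! i \<bullet>c ws ! i) \<ge> 0" by (simp add: sum_nonneg)
    have ne: "ws ! i \<bullet>c ws ! i \<noteq> 0" using corthogonalD[OF gs(2), of i i] i len by auto
    then have "Re (ws ! i \<bullet>c ws ! i) \<noteq> 0" using e by (simp only: Re_complex_of_real of_real_eq_0_iff not_False_eq_True)
    then show "r i \<noteq> 0" by (simp add: r_def)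
    have "r i * r i = Re (ws ! i \<bullet>c ws ! i)" using ge by (simp add: r_def)
    then show "complex_of_real (r i) * complex_of_real (r i) = ws ! i \<bullet>c ws ! i"
      using e by (metis of_real_mult Re_complex_of_real)
  qed
  have "mat_adjoint U * U = 1\<^sub>m n"
  proof (rule eq_matI)
    fix i j assume "i < dim_row (1\<^sub>m n)" "j < dim_col (1\<^sub>m n)"
    then have ij: "i < n" "j < n" by auto
    have "(mat_adjoint U * U) $$ (i, j) = (\<Sum>k<n. cnj (U $$ (k, i)) * U $$ (k, j))"
      using ij U by (subst mult_mat_index_sum[of _ n n _ n]) auto
    also have "\<dots> = (\<Sum>k<n. ws ! j $ k * cnj (ws ! i $ k) / (complex_of_real (r i) * complex_of_real (r j)))"
      using ij by (intro sum.cong) (auto simp: U_def)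
    also have "\<dots> = (ws ! j \<bullet>c ws ! i) / (complex_of_real (r i) * complex_of_real (r j))"
      unfolding sp[OF ij] by (simp add: sum_divide_distrib)
    also have "\<dots> = (if i = j then 1 else 0)"
      using rr[of i] rr[of j] ij corthogonalD[OF gs(2), of j i] len by auto
    finally show "(mat_adjoint U * U) $$ (i, j) = 1\<^sub>m n $$ (i, j)" using ij by simp
  qed (use U in auto)
  moreover have "col U 0 = (1 / complex_of_real (r 0)) \<cdot>\<^sub>v v"
    using n0 v hd by (intro eq_vecI) (auto simp: U_def)
  ultimately show thesis using that U by blast
qed

lemma mat_adjoint_four_block_diag:
  assumes "A \<in> carrier_mat k k" "B \<in> carrier_mat n n"
  shows "mat_adjoint (four_block_mat A (0\<^sub>m k n) (0\<^sub>m n k) B :: complex mat)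
    = four_block_mat (mat_adjoint A) (0\<^sub>m k n) (0\<^sub>m n k) (mat_adjoint B)"
  using assms by (intro eq_matI) auto

lemma mult_four_block_diag:
  fixes A A' B B' :: "complex mat"
  assumes "A \<in> carrier_mat k k" "B \<in> carrier_mat n n" "A' \<in> carrier_mat k k" "B' \<in> carrier_mat n n"
  shows "four_block_mat A (0\<^sub>m k n) (0\<^sub>m n k) B * four_block_mat A' (0\<^sub>m k n) (0\<^sub>m n k) B'
    = four_block_mat (A * A') (0\<^sub>m k n) (0\<^sub>m n k) (B * B')"
  using assms by (subst mult_four_block_mat[of _ k k _ n _ n _ _ k _ n]) auto

text \<open>Deflation: conjugating by a unitary \<open>W\<close> whose first column is an
  eigenvector clears the first column of \<open>M\<close> below the diagonal, and hermiticity clears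
  the first row. What remains is a Hermitian block of size \<open>n\<close>. The diagonal
  \<open>f\<close> is complex here; for Gram matrices it is shown to be real and nonnegative
  separately.\<close>

theorem hermitian_unitary_diagonalisation:
  fixes A :: "complex mat"
  assumes "A \<in> carrier_mat n n" "mat_adjoint A = A"
  shows "\<exists>U f. U \<in> carrier_mat n n \<and> mat_adjoint U * U = 1\<^sub>m n \<and> U * mat_adjoint U = 1\<^sub>m n \<and>
    A = U * mat_diag n f * mat_adjoint U"
  using assms
proof (induction n arbitrary: A)
  case 0
  then show ?case by (intro exI[of _ "1\<^sub>m 0"] exI[of _ "\<lambda>_. 0"]) auto
next
  case (Suc n)
  note A = Suc.prems(1) and herm = Suc.prems(2)
  obtain e where "eigenvalue A e"
    using spectrum_non_empty[OF A] by (auto simp: spectrum_def)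
  then obtain v where v: "v \<in> carrier_vec (Suc n)" "v \<noteq> 0\<^sub>v (Suc n)" "A *\<^sub>v v = e \<cdot>\<^sub>v v"
    using A by (auto simp: eigenvalue_def eigenvector_def)
  obtain W c where W: "W \<in> carrier_mat (Suc n) (Suc n)" "mat_adjoint W * W = 1\<^sub>m (Suc n)"
    and W0: "col W 0 = c \<cdot>\<^sub>v v"
    using exists_unitary_first_column[OF v(1,2)] by blast
  let ?W' = "mat_adjoint W"
  have W': "?W' \<in> carrier_mat (Suc n) (Suc n)" using W by simp
  have WW': "W * ?W' = 1\<^sub>m (Suc n)" using mat_mult_left_right_inverse[OF W' W(1) W(2)] .
  define M where "M = ?W' * A * W"
  note as = assoc_mult_mat[of _ "Suc n" "Suc n" _ "Suc n" _ "Suc n"]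
    and mc = mult_carrier_mat[of _ "Suc n" "Suc n" _ "Suc n"]
  have M: "M \<in> carrier_mat (Suc n) (Suc n)" using W W' A by (simp add: M_def mc)
  have M_herm: "mat_adjoint M = M"
    unfolding M_def using W W' A herm
    by (simp add: mat_adjoint_mult[of _ "Suc n" "Suc n" _ "Suc n"] as mc)
  have "A *\<^sub>v col W 0 = e \<cdot>\<^sub>v col W 0"
    unfolding W0 using v A by (simp add: mult_mat_vec smult_smult_assoc mult.commute)
  then have AW0: "col (A * W) 0 = e \<cdot>\<^sub>v col W 0"
    using A W by (subst col_mult2[of _ "Suc n" "Suc n" _ "Suc n"]) auto
  have M0: "M $$ (i, 0) = (if i = 0 then e else 0)" if i: "i < Suc n" for i
  proof -
    have "M = ?W' * (A * W)" unfolding M_def using W(1) W' A by (simp add: as mc)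
    then have "M $$ (i, 0) = row ?W' i \<bullet> col (A * W) 0" using i W W' A by simp
    also have "\<dots> = e * (row ?W' i \<bullet> col W 0)"
      unfolding AW0 using i W(1) W' by (intro scalar_prod_smult_distrib[of _ "Suc n"] carrier_vecI) (simp_all del: col_dim)
    also have "row ?W' i \<bullet> col W 0 = (?W' * W) $$ (i, 0)" using i W(1) W' by simp
    finally show ?thesis unfolding W(2) using i by simp
  qed
  \<comment> \<open>The first row is the conjugate of the first column, and the corner entry of the
    Hermitian \<open>M\<close> shows that \<open>e\<close> is real.\<close>
  have M0': "M $$ (0, i) = (if i = 0 then e else 0)" if i: "i < Suc n" for i
  proof -
    have "M $$ (0, i) = cnj (M $$ (i, 0))"
      using mat_adjoint_index[of 0 M i] M i unfolding M_herm by simp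
    moreover have "e = cnj e" using mat_adjoint_index[of 0 M 0] M M0[of 0] unfolding M_herm by simp
    ultimately show ?thesis using M0[OF i] by simp
  qed
  define B where "B = Matrix.mat n n (\<lambda>(i, j). M $$ (Suc i, Suc j))"
  have B: "B \<in> carrier_mat n n" by (simp add: B_def)
  have B_herm: "mat_adjoint B = B"
  proof (rule eq_matI)
    fix i j assume "i < dim_row B" "j < dim_col B"
    then show "mat_adjoint B $$ (i, j) = B $$ (i, j)"
      using mat_adjoint_index[of "Suc i" M "Suc j"] M unfolding M_herm by (simp add: B_def)
  qed (auto simp: B_def)
  obtain V f where V: "V \<in> carrier_mat n n" "mat_adjoint V * V = 1\<^sub>m n" "V * mat_adjoint V = 1\<^sub>m n"
    "B = V * mat_diag n f * mat_adjoint V"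
    using Suc.IH[OF B B_herm] by blast
  let ?bl = "\<lambda>X Y :: complex mat. four_block_mat X (0\<^sub>m 1 n) (0\<^sub>m n 1) Y"
  define g where "g i = (case i of 0 \<Rightarrow> e | Suc j \<Rightarrow> f j)" for i
  have Mbl: "M = ?bl (mat_diag 1 (\<lambda>_. e)) B"
  proof (rule eq_matI)
    fix i j assume "i < dim_row (?bl (mat_diag 1 (\<lambda>_. e)) B)" "j < dim_col (?bl (mat_diag 1 (\<lambda>_. e)) B)"
    then have "i < Suc n" "j < Suc n" by (simp_all add: B_def mat_diag_def)
    then show "M $$ (i, j) = ?bl (mat_diag 1 (\<lambda>_. e)) B $$ (i, j)"
      using M0[of i] M0'[of j] by (cases i; cases j) (simp_all add: B_def mat_diag_def)
  qed (use M in \<open>simp_all add: B_def mat_diag_def\<close>)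
  have Dbl: "mat_diag (Suc n) g = ?bl (mat_diag 1 (\<lambda>_. e)) (mat_diag n f)"
  proof (rule eq_matI)
    fix i j assume "i < dim_row (?bl (mat_diag 1 (\<lambda>_. e)) (mat_diag n f))"
      "j < dim_col (?bl (mat_diag 1 (\<lambda>_. e)) (mat_diag n f))"
    then have "i < Suc n" "j < Suc n" by (simp_all add: mat_diag_def)
    then show "mat_diag (Suc n) g $$ (i, j) = ?bl (mat_diag 1 (\<lambda>_. e)) (mat_diag n f) $$ (i, j)"
      by (cases i; cases j) (simp_all add: mat_diag_def g_def)
  qed (simp_all add: mat_diag_def)
  define Z where "Z = ?bl (1\<^sub>m 1) V"
  have adj1: "mat_adjoint (1\<^sub>m 1) = (1\<^sub>m 1 :: complex mat)" by (intro eq_matI) auto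
  have Z: "Z \<in> carrier_mat (Suc n) (Suc n)" 
    unfolding Z_def using four_block_carrier_mat[of "1\<^sub>m 1" 1 1 V n n] V(1) by simp
  have Zadj: "mat_adjoint Z = ?bl (1\<^sub>m 1) (mat_adjoint V)"
    unfolding Z_def using mat_adjoint_four_block_diag[of "1\<^sub>m 1" 1 V n] V(1) adj1 by simp
  have Z': "mat_adjoint Z \<in> carrier_mat (Suc n) (Suc n)" using Z by simp
  have ZZ: "mat_adjoint Z * Z = 1\<^sub>m (Suc n)"
    unfolding Zadj unfolding Z_def using V(1,2) by (subst mult_four_block_diag) auto
  have ZD: "M = Z * mat_diag (Suc n) g * mat_adjoint Z"
    unfolding Zadj unfolding Dbl Z_def Mbl V(4)
    by (simp only: mult_four_block_diag one_carrier_mat mat_diag_dim V(1) mat_adjoint_carrier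
        mult_carrier_mat[of _ n n _ n] left_mult_one_mat[of _ 1 1] right_mult_one_mat[of _ 1 1])
  define U where "U = W * Z"
  have U: "U \<in> carrier_mat (Suc n) (Suc n)" using W Z by (simp add: U_def mc)
  have Uadj: "mat_adjoint U = mat_adjoint Z * ?W'" unfolding U_def using mat_adjoint_mult[OF W(1) Z] .
  have "mat_adjoint U * U = mat_adjoint Z * ((?W' * W) * Z)"
    unfolding Uadj unfolding U_def using W(1) W' Z Z' by (simp add: as mc)
  then have UU: "mat_adjoint U * U = 1\<^sub>m (Suc n)" unfolding W(2) using Z ZZ by simp
  then have UU': "U * mat_adjoint U = 1\<^sub>m (Suc n)"
    using mat_mult_left_right_inverse[of "mat_adjoint U" "Suc n" U] U by simp
  have "A = (W * ?W') * A * (W * ?W')" unfolding WW' using A by simp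
  also have "\<dots> = W * M * ?W'" unfolding M_def using W(1) W' A by (simp add: as mc)
  also have "\<dots> = U * mat_diag (Suc n) g * mat_adjoint U"
    unfolding Uadj unfolding ZD U_def using W(1) W' Z Z' by (simp add: as mc)
  finally show ?case using U UU UU' by blast
qed

subsection \<open>The spectrum of Gram matrices\<close>

text \<open>The sum of the rank-one matrices built from the vectors \<open>Y i\<close>. The index
  \<open>i\<close> stands for a basis state of the traced-out system; its type is left open because
  one copy uses numbers and two copies use pairs.\<close>

definition gram_mat :: "nat \<Rightarrow> 'i set \<Rightarrow> ('i \<Rightarrow> nat \<Rightarrow> complex) \<Rightarrow> complex mat" where
  "gram_mat n I Y = Matrix.mat n n (\<lambda>(k, l). \<Sum>i\<in>I. Y i k * cnj (Y i l))"

lemma gram_mat_carrier [simp]: "gram_mat n I Y \<in> carrier_mat n n"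
  and gram_mat_dim [simp]: "dim_row (gram_mat n I Y) = n" "dim_col (gram_mat n I Y) = n"
  by (simp_all add: gram_mat_def)

lemma gram_mat_index:
  "k < n \<Longrightarrow> l < n \<Longrightarrow> gram_mat n I Y $$ (k, l) = (\<Sum>i\<in>I. Y i k * cnj (Y i l))"
  by (simp add: gram_mat_def)

lemma cmod_sq_sum:
  "complex_of_real ((cmod (\<Sum>k\<in>K. g k))\<^sup>2) = (\<Sum>k\<in>K. \<Sum>l\<in>K. g k * cnj (g l))"
  by (simp only: complex_norm_square cnj_sum sum_product)

text \<open>\<open>f j\<close> is the value of the quadratic form of the matrix at column
  \<open>j\<close> of \<open>U\<close>, and on a sum of rank-one matrices this form is a sum of
  squared moduli of inner products. Realness and nonnegativity of the eigenvalues can be read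
  off.\<close>

lemma unitary_diagonal_entry:
  fixes U :: "complex mat"
  assumes U: "U \<in> carrier_mat n n" "mat_adjoint U * U = 1\<^sub>m n"
    and A: "gram_mat n I Y = U * mat_diag n f * mat_adjoint U" and j: "j < n"
  shows "f j = complex_of_real (\<Sum>i\<in>I. (cmod (\<Sum>k<n. Y i k * cnj (U $$ (k, j))))\<^sup>2)"
proof -
  let ?A = "gram_mat n I Y" and ?U' = "mat_adjoint U"
  have U': "?U' \<in> carrier_mat n n" using U by simp
  note as = assoc_mult_mat[of _ n n _ n _ n] and mc = mult_carrier_mat[of _ n n _ n]
  have "?U' * ?A * U = (?U' * U) * mat_diag n f * (?U' * U)"
    unfolding A using U(1) U' by (simp add: as mc)
  then have "f j = (?U' * ?A * U) $$ (j, j)"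
    unfolding U(2) using j by (simp add: left_mult_one_mat[of _ n n] right_mult_one_mat[of _ n n] mat_diag_def)
  also have "\<dots> = (\<Sum>l<n. (\<Sum>k<n. cnj (U $$ (k, j)) * ?A $$ (k, l)) * U $$ (l, j))"
    using U U' j by (subst mult_mat_index_sum[of _ n n _ n])
      (auto simp: mc mult_mat_index_sum[of ?U' n n ?A n] simp del: index_mult_mat(1) intro!: sum.cong)
  also have "\<dots> = (\<Sum>l<n. \<Sum>k<n. \<Sum>i\<in>I. (Y i k * cnj (U $$ (k, j))) * cnj (Y i l * cnj (U $$ (l, j))))"
    by (auto simp: gram_mat_index sum_distrib_left sum_distrib_right mult_ac intro!: sum.cong)
  also have "\<dots> = (\<Sum>i\<in>I. \<Sum>k<n. \<Sum>l<n. (Y i k * cnj (U $$ (k, j))) * cnj (Y i l * cnj (U $$ (l, j))))"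
    unfolding sum.swap[where B = I] by (intro sum.cong refl sum.swap)
  finally show ?thesis
    unfolding of_real_sum cmod_sq_sum .
qed

lemma unitary_column_norm:
  fixes U :: "complex mat"
  assumes U: "U \<in> carrier_mat n n" "mat_adjoint U * U = 1\<^sub>m n" and j: "j < n"
  shows "(\<Sum>k<n. (cmod (U $$ (k, j)))\<^sup>2) = 1"
proof -
  have "complex_of_real (\<Sum>k<n. (cmod (U $$ (k, j)))\<^sup>2) = (\<Sum>k<n. mat_adjoint U $$ (j, k) * U $$ (k, j))"
    unfolding of_real_sum complex_norm_square using U j by (intro sum.cong) (auto simp: mult.commute)
  also have "\<dots> = (mat_adjoint U * U) $$ (j, j)"
    using U(1) j by (subst mult_mat_index_sum[of _ n n _ n]) auto
  also have "\<dots> = 1" unfolding U(2) using j by simp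
  finally show ?thesis by (metis of_real_eq_1_iff)
qed

lemma mat_trace_unitary_conj:
  fixes U :: "complex mat"
  assumes U: "U \<in> carrier_mat n n" "mat_adjoint U * U = 1\<^sub>m n"
  shows "mat_trace (U * mat_diag n f * mat_adjoint U) = (\<Sum>j<n. f j)"
proof -
  let ?D = "U * mat_diag n f"
  have D: "?D \<in> carrier_mat n n" "\<And>i j. i < n \<Longrightarrow> j < n \<Longrightarrow> ?D $$ (i, j) = U $$ (i, j) * f j"
    using U by (auto simp: mat_diag_mult_right[of _ n n])
  have "mat_trace (?D * mat_adjoint U) = (\<Sum>i<n. \<Sum>j<n. ?D $$ (i, j) * mat_adjoint U $$ (j, i))"
    unfolding mat_trace_def using U D(1)
    by (intro sum.cong) (auto simp: mult_mat_index_sum[of ?D n n _ n] simp del: index_mult_mat(1))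
  also have "\<dots> = (\<Sum>i<n. \<Sum>j<n. f j * complex_of_real ((cmod (U $$ (i, j)))\<^sup>2))"
    using U by (intro sum.cong) (auto simp: D(2) complex_norm_square simp del: of_real_power)
  also have "\<dots> = (\<Sum>j<n. f j * complex_of_real (\<Sum>i<n. (cmod (U $$ (i, j)))\<^sup>2))"
    by (subst sum.swap) (simp add: sum_distrib_left)
  also have "\<dots> = (\<Sum>j<n. f j)"
    using unitary_column_norm[OF U] by (intro sum.cong) auto
  finally show ?thesis .
qed

lemma mat_trace_gram_mat:
  "mat_trace (gram_mat n I Y) = complex_of_real (\<Sum>i\<in>I. \<Sum>k<n. (cmod (Y i k))\<^sup>2)"
  unfolding mat_trace_def of_real_sum complex_norm_square
  by (simp add: gram_mat_index sum.swap[where A = I])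

text \<open>As \<open>psd_powr\<close> is a choice, its defining property becomes available only
  once some diagonalisation with nonnegative real eigenvalues is exhibited; \<open>g\<close>
  supplies these eigenvalues.\<close>

lemma gram_mat_spectral_powr:
  "spectral_powr (gram_mat n I Y) p (psd_powr (gram_mat n I Y) p)"
proof -
  let ?A = "gram_mat n I Y"
  have "mat_adjoint ?A = ?A"
    by (rule eq_matI) (auto simp: gram_mat_index mult.commute)
  then obtain U f where U: "U \<in> carrier_mat n n" "mat_adjoint U * U = 1\<^sub>m n" "U * mat_adjoint U = 1\<^sub>m n"
    and A: "?A = U * mat_diag n f * mat_adjoint U"
    using hermitian_unitary_diagonalisation[OF gram_mat_carrier] by metis
  define g where "g j = (\<Sum>i\<in>I. (cmod (\<Sum>k<n. Y i k * cnj (U $$ (k, j))))\<^sup>2)" for j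
  have "mat_diag n f = mat_diag n (\<lambda>j. complex_of_real (g j))"
    using unitary_diagonal_entry[OF U(1,2) A]
    by (intro eq_matI) (auto simp: mat_diag_def g_def)
  moreover have "g j \<ge> 0" for j by (simp add: g_def sum_nonneg)
  ultimately have "\<exists>B. spectral_powr ?A p B"
    unfolding spectral_powr_def gram_mat_dim using U A
    by (intro exI[of _ "U * mat_diag n (\<lambda>j. complex_of_real (g j powr p)) * mat_adjoint U"]
        exI[of _ U] exI[of _ g]) simp
  then show ?thesis unfolding psd_powr_def by (rule someI_ex)
qed

text \<open>
  \<open>f j\<close> are the eigenvalues; \<open>u j\<close> is the entrywise conjugate of a unit eigenvector for \<open>f j\<close>.
\<close>

lemma gram_mat_spectrum:
  obtains u :: "nat \<Rightarrow> nat \<Rightarrow> complex" and f :: "nat \<Rightarrow> real"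
  where "\<And>j. j < n \<Longrightarrow> (\<Sum>k<n. (cmod (u j k))\<^sup>2) = 1"
    and "\<And>j. j < n \<Longrightarrow> f j = (\<Sum>i\<in>I. (cmod (\<Sum>k<n. Y i k * u j k))\<^sup>2)"
    and "(\<Sum>j<n. f j) = (\<Sum>i\<in>I. \<Sum>k<n. (cmod (Y i k))\<^sup>2)"
    and "renyi_entropy p (gram_mat n I Y) = 1 / (1 - p) * log 2 (\<Sum>j<n. f j powr p)"
    and "\<And>v c. v \<in> carrier_vec n \<Longrightarrow> v \<noteq> 0\<^sub>v n \<Longrightarrow>
      gram_mat n I Y *\<^sub>v v = complex_of_real c \<cdot>\<^sub>v v \<Longrightarrow> \<exists>j<n. f j = c"
proof -
  let ?A = "gram_mat n I Y"
  \<comment> \<open>The decomposition behind the chosen \<open>psd_powr\<close> is taken, so that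
    the eigenvalue facts and the entropy formula concern the same \<open>f\<close>.\<close>
  obtain U f where U: "U \<in> carrier_mat n n" "mat_adjoint U * U = 1\<^sub>m n" "U * mat_adjoint U = 1\<^sub>m n"
    and A: "?A = U * mat_diag n (\<lambda>j. complex_of_real (f j)) * mat_adjoint U"
    and P: "psd_powr ?A p = U * mat_diag n (\<lambda>j. complex_of_real (f j powr p)) * mat_adjoint U"
    using gram_mat_spectral_powr[of n I Y p] unfolding spectral_powr_def gram_mat_dim by blast
  have 1: "(\<Sum>k<n. (cmod (cnj (U $$ (k, j))))\<^sup>2) = 1" if "j < n" for j
    using unitary_column_norm[OF U(1,2) that] by simp
  have 2: "f j = (\<Sum>i\<in>I. (cmod (\<Sum>k<n. Y i k * cnj (U $$ (k, j))))\<^sup>2)" if "j < n" for j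
    using unitary_diagonal_entry[OF U(1,2) A that] by (simp only: of_real_eq_iff)
  have "complex_of_real (\<Sum>j<n. f j) = complex_of_real (\<Sum>i\<in>I. \<Sum>k<n. (cmod (Y i k))\<^sup>2)"
    unfolding mat_trace_gram_mat[of n I Y, symmetric] A mat_trace_unitary_conj[OF U(1,2)] by simp
  then have 3: "(\<Sum>j<n. f j) = (\<Sum>i\<in>I. \<Sum>k<n. (cmod (Y i k))\<^sup>2)"
    by (simp only: of_real_eq_iff)
  have 4: "renyi_entropy p ?A = 1 / (1 - p) * log 2 (\<Sum>j<n. f j powr p)"
    unfolding renyi_entropy_def P mat_trace_unitary_conj[OF U(1,2)] by simp
  \<comment> \<open>In the coordinates \<open>w\<close> given by the columns of \<open>U\<close> the
    eigenvector equation reads f j * w j = c * w j, and some coordinate of \<open>w\<close> is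
    nonzero.\<close>
  have 5: "\<exists>j<n. f j = c"
    if v: "v \<in> carrier_vec n" "v \<noteq> 0\<^sub>v n" "?A *\<^sub>v v = complex_of_real c \<cdot>\<^sub>v v" for v c
  proof -
    let ?U' = "mat_adjoint U" and ?D = "mat_diag n (\<lambda>j. complex_of_real (f j))"
    define w where "w = ?U' *\<^sub>v v"
    have U': "?U' \<in> carrier_mat n n" using U by simp
    have w: "w \<in> carrier_vec n" using U' v by (simp add: w_def mult_mat_vec_carrier[of _ n n])
    have D: "?D \<in> carrier_mat n n" by simp
    have vw: "v = U *\<^sub>v w"
      unfolding w_def using U U' v by (simp add: assoc_mult_mat_vec[of _ n n _ n, symmetric])
    have "?U' * ?A = (?U' * U) * ?D * ?U'"
      unfolding A using U(1) U' by (simp add: assoc_mult_mat[of _ n n _ n _ n] mult_carrier_mat[of _ n n _ n])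
    then have "?U' * ?A = ?D * ?U'" unfolding U(2) by (simp add: left_mult_one_mat[of _ n n])
    then have "?D *\<^sub>v w = ?U' *\<^sub>v (?A *\<^sub>v v)"
      unfolding w_def using U' v by (metis assoc_mult_mat_vec D gram_mat_carrier)
    also have "\<dots> = complex_of_real c \<cdot>\<^sub>v w"
      unfolding v(3) w_def using U' v by (simp add: mult_mat_vec)
    finally have Dw: "?D *\<^sub>v w = complex_of_real c \<cdot>\<^sub>v w" .
    have "w \<noteq> 0\<^sub>v n"
    proof
      assume "w = 0\<^sub>v n"
      then have "v = 0\<^sub>v n" unfolding vw using U(1) by (intro eq_vecI) (auto simp: scalar_prod_def)
      with v(2) show False ..
    qed
    then obtain j where j: "j < n" "w $ j \<noteq> 0" using w by (auto simp: vec_eq_iff)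
    have "(?D *\<^sub>v w) $ j = (\<Sum>k<n. if k = j then complex_of_real (f j) * w $ j else 0)"
      unfolding mult_mat_vec_index_sum[OF D w j(1)] using j by (intro sum.cong) (auto simp: mat_diag_def)
    then have "complex_of_real (f j) * w $ j = complex_of_real c * w $ j"
      unfolding Dw using j w by simp
    with j show ?thesis by auto
  qed
  show thesis
    by (rule that[of "\<lambda>j k. cnj (U $$ (k, j))" f]) (use 1 2 3 4 5 in blast)+
qed

subsection \<open>A single copy of the channel\<close>

lemma sum_lessThan_mult:
  "(\<Sum>r<m * n. h r) = (\<Sum>i<m. \<Sum>k<n. h (i * n + k))" for h :: "nat \<Rightarrow> 'a::comm_monoid_add"
  unfolding sum.nat_group[of h n m, symmetric]
  by (simp add: sum.atLeastLessThan_shift_0[of h] atLeast0LessThan)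

lemma cscalar_prod_self:
  "v \<in> carrier_vec n \<Longrightarrow> v \<bullet>c v = complex_of_real (\<Sum>k<n. (cmod (v $ k))\<^sup>2)" for v :: "complex vec"
  unfolding of_real_sum complex_norm_square by (simp add: scalar_prod_def atLeast0LessThan)

lemma unit_vector_norm:
  "v \<in> carrier_vec n \<Longrightarrow> v \<bullet>c v = 1 \<Longrightarrow> (\<Sum>k<n. (cmod (v $ k))\<^sup>2) = 1" for v :: "complex vec"
  by (simp only: cscalar_prod_self of_real_eq_1_iff)

lemma antisym_channel_index:
  assumes \<rho>: "\<rho> \<in> carrier_mat (d choose 2) (d choose 2)" and kl: "k < d" "l < d"
  shows "antisym_channel d \<rho> $$ (k, l) = (\<Sum>i<d. \<Sum>a<d choose 2. \<Sum>b<d choose 2.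
    antisym_isometry d $$ (i * d + k, a) * \<rho> $$ (a, b) * cnj (antisym_isometry d $$ (i * d + l, b)))"
proof -
  let ?W = "antisym_isometry d" and ?N = "d choose 2"
  have W: "?W \<in> carrier_mat (d * d) ?N" "mat_adjoint ?W \<in> carrier_mat ?N (d * d)" by auto
  have W\<rho>: "?W * \<rho> \<in> carrier_mat (d * d) ?N" using \<rho> W by (simp add: mult_carrier_mat[of _ _ ?N])
  have "(?W * \<rho> * mat_adjoint ?W) $$ (i * d + k, i * d + l) =
      (\<Sum>b<?N. \<Sum>a<?N. ?W $$ (i * d + k, a) * \<rho> $$ (a, b) * cnj (?W $$ (i * d + l, b)))" if "i < d" for i
    using that kl carrier_matD[OF W(1)]
    by (simp del: index_mult_mat(1) add: pair_index_less mult_mat_index_sum[OF W\<rho> W(2)]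
        mult_mat_index_sum[OF W(1) \<rho>] sum_distrib_right)
  then show ?thesis
    using kl by (simp add: antisym_channel_def partial_trace_fst_def) (intro sum.cong refl sum.swap)
qed

lemma antisym_channel_dim [simp]:
  "dim_row (antisym_channel d \<rho>) = d" "dim_col (antisym_channel d \<rho>) = d"
  by (simp_all add: antisym_channel_def partial_trace_fst_def)

text \<open>Fixing the basis state \<open>i\<close> of the traced-out first factor, the amplitudes
  of \<open>W \<psi>\<close> over the second factor form the vector \<open>Y i\<close>. For a pure
  input the double sum over input indices factors into such an amplitude and a conjugate
  one.\<close>

lemma antisym_channel_ket_bra:
  assumes \<psi>: "\<psi> \<in> carrier_vec (d choose 2)"
  shows "antisym_channel d (ket_bra \<psi>) = gram_mat d {..<d} (\<lambda>i k. (antisym_isometry d *\<^sub>v \<psi>) $ (i * d + k))"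
proof (rule eq_matI)
  fix k l assume "k < dim_row (gram_mat d {..<d} (\<lambda>i k. (antisym_isometry d *\<^sub>v \<psi>) $ (i * d + k)))"
    "l < dim_col (gram_mat d {..<d} (\<lambda>i k. (antisym_isometry d *\<^sub>v \<psi>) $ (i * d + k)))"
  then have kl: "k < d" "l < d" by auto
  have kb: "ket_bra \<psi> \<in> carrier_mat (d choose 2) (d choose 2)" using \<psi> by (simp add: ket_bra_def)
  show "antisym_channel d (ket_bra \<psi>) $$ (k, l) =
    gram_mat d {..<d} (\<lambda>i k. (antisym_isometry d *\<^sub>v \<psi>) $ (i * d + k)) $$ (k, l)"
    unfolding antisym_channel_index[OF kb kl] gram_mat_index[OF kl]
  proof (intro sum.cong refl)
    fix i assume "i \<in> {..<d}"
    then have i: "i < d" by simp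
    show "(\<Sum>a<d choose 2. \<Sum>b<d choose 2. antisym_isometry d $$ (i * d + k, a) * ket_bra \<psi> $$ (a, b) *
        cnj (antisym_isometry d $$ (i * d + l, b))) =
      (antisym_isometry d *\<^sub>v \<psi>) $ (i * d + k) * cnj ((antisym_isometry d *\<^sub>v \<psi>) $ (i * d + l))"
      unfolding antisym_isometry_mult[OF \<psi> pair_index_less[OF i kl(1)]]
        antisym_isometry_mult[OF \<psi> pair_index_less[OF i kl(2)]] cnj_sum sum_product
      using \<psi> by (intro sum.cong refl) (simp add: ket_bra_def)
  qed
qed auto

lemma isometry_preserves_norm:
  fixes W :: "complex mat"
  assumes W: "W \<in> carrier_mat m n" "mat_adjoint W * W = 1\<^sub>m n" and x: "x \<in> carrier_vec n"
  shows "(\<Sum>r<m. (cmod ((W *\<^sub>v x) $ r))\<^sup>2) = (\<Sum>k<n. (cmod (x $ k))\<^sup>2)"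
proof -
  have "complex_of_real (\<Sum>r<m. (cmod ((W *\<^sub>v x) $ r))\<^sup>2)
      = (\<Sum>r<m. \<Sum>k<n. \<Sum>l<n. (W $$ (r, k) * x $ k) * cnj (W $$ (r, l) * x $ l))"
    unfolding of_real_sum using W x
    by (intro sum.cong refl) (simp only: mult_mat_vec_index_sum[OF W(1) x] lessThan_iff cmod_sq_sum)
  also have "\<dots> = (\<Sum>k<n. \<Sum>l<n. \<Sum>r<m. (W $$ (r, k) * x $ k) * cnj (W $$ (r, l) * x $ l))"
    by (subst sum.swap) (intro sum.cong refl sum.swap)
  also have "\<dots> = (\<Sum>k<n. \<Sum>l<n. (mat_adjoint W * W) $$ (l, k) * (x $ k * cnj (x $ l)))"
    using carrier_matD[OF W(1)]
    by (intro sum.cong refl)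
      (simp del: index_mult_mat(1) add: mult_mat_index_sum[OF mat_adjoint_carrier[OF W(1)] W(1)]
        sum_distrib_right sum_distrib_left mult_ac)
  also have "\<dots> = (\<Sum>k<n. \<Sum>l<n. if l = k then x $ k * cnj (x $ k) else 0)"
    unfolding W(2) by (intro sum.cong refl) auto
  also have "\<dots> = complex_of_real (\<Sum>k<n. (cmod (x $ k))\<^sup>2)"
    unfolding of_real_sum complex_norm_square by simp
  finally show ?thesis by (simp only: of_real_eq_iff)
qed

text \<open>
  With \<open>w = Y u\<close>, the antisymmetric matrix \<open>Z i k = w i * cnj (u k) - cnj (u i) * w k\<close> has inner product
  \<open>2 |w|\<^sup>2\<close> with \<open>Y\<close> and squared norm at most \<open>2 |w|\<^sup>2\<close>; the bound is \<open>|Y - Z|\<^sup>2 \<ge> 0\<close>.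
\<close>

lemma antisymmetric_norm_bound:
  fixes Y :: "nat \<Rightarrow> nat \<Rightarrow> complex" and u :: "nat \<Rightarrow> complex"
  assumes anti: "\<And>i k. i < d \<Longrightarrow> k < d \<Longrightarrow> Y k i = - Y i k"
    and u: "(\<Sum>k<d. (cmod (u k))\<^sup>2) = 1"
  shows "2 * (\<Sum>i<d. (cmod (\<Sum>k<d. Y i k * u k))\<^sup>2) \<le> (\<Sum>i<d. \<Sum>k<d. (cmod (Y i k))\<^sup>2)"
proof -
  define w where "w i = (\<Sum>k<d. Y i k * u k)" for i
  define q where "q = (\<Sum>i<d. (cmod (w i))\<^sup>2)"
  define s where "s = (\<Sum>i<d. w i * u i)"
  define Z where "Z i k = w i * cnj (u k) - cnj (u i) * w k" for i k
  have q: "(\<Sum>i<d. w i * cnj (w i)) = complex_of_real q"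
    unfolding q_def of_real_sum complex_norm_square ..
  have uu: "(\<Sum>i<d. u i * cnj (u i)) = 1"
    using arg_cong[OF u, of complex_of_real] unfolding of_real_sum complex_norm_square by simp
  have "(\<Sum>i<d. \<Sum>k<d. Y i k * cnj (w i) * u k) = complex_of_real q"
    unfolding q[symmetric] by (intro sum.cong refl) (subst (2) w_def, simp add: sum_distrib_left sum_distrib_right mult_ac)
  \<comment> \<open>Exchanging the roles of \<open>i\<close> and \<open>k\<close> costs a sign by
    antisymmetry. Hence the second term of \<open>Z\<close> contributes another \<open>q\<close> to
    the inner product with \<open>Y\<close>, which is the origin of the factor 2.\<close>
  moreover have "(\<Sum>i<d. \<Sum>k<d. Y i k * u i * cnj (w k)) = - complex_of_real q"
  proof -
    have flip: "Y i k * u i * cnj (w k) = - Y k i * u i * cnj (w k)" if "i < d" "k < d" for i k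
      unfolding anti[OF that] by simp
    have "(\<Sum>i<d. \<Sum>k<d. Y i k * u i * cnj (w k)) = (\<Sum>k<d. (\<Sum>i<d. - Y k i * u i) * cnj (w k))"
      unfolding sum_distrib_right by (subst sum.swap) (intro sum.cong refl flip, simp_all)
    also have "\<dots> = (\<Sum>k<d. - (w k * cnj (w k)))"
      by (simp add: w_def sum_negf)
    finally show ?thesis by (simp add: sum_negf q)
  qed
  ultimately have YZ: "(\<Sum>i<d. \<Sum>k<d. Y i k * cnj (Z i k)) = 2 * complex_of_real q"
    by (simp add: Z_def algebra_simps sum_subtractf)
  have ZY: "(\<Sum>i<d. \<Sum>k<d. Z i k * cnj (Y i k)) = 2 * complex_of_real q"
    using arg_cong[OF YZ, of cnj] by (simp add: mult.commute)
  have "(\<Sum>i<d. \<Sum>k<d. Z i k * cnj (Z i k)) =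
      (\<Sum>i<d. \<Sum>k<d. (w i * cnj (w i)) * (u k * cnj (u k))) + (\<Sum>i<d. \<Sum>k<d. (u i * cnj (u i)) * (w k * cnj (w k)))
      - (\<Sum>i<d. \<Sum>k<d. (w i * u i) * (cnj (w k * u k))) - (\<Sum>i<d. \<Sum>k<d. cnj (w i * u i) * (w k * u k))"
    unfolding sum.distrib[symmetric] sum_subtractf[symmetric]
    by (intro sum.cong refl) (simp add: Z_def algebra_simps)
  also have "\<dots> = 2 * complex_of_real q - 2 * complex_of_real ((cmod s)\<^sup>2)"
    unfolding sum_product[symmetric] q uu complex_norm_square cnj_sum[symmetric] s_def[symmetric] by simp
  finally have ZZ: "(\<Sum>i<d. \<Sum>k<d. Z i k * cnj (Z i k)) = 2 * complex_of_real q - 2 * complex_of_real ((cmod s)\<^sup>2)" .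
  have "complex_of_real (\<Sum>i<d. \<Sum>k<d. (cmod (Y i k - Z i k))\<^sup>2) =
      (\<Sum>i<d. \<Sum>k<d. Y i k * cnj (Y i k)) - (\<Sum>i<d. \<Sum>k<d. Y i k * cnj (Z i k))
      - (\<Sum>i<d. \<Sum>k<d. Z i k * cnj (Y i k)) + (\<Sum>i<d. \<Sum>k<d. Z i k * cnj (Z i k))"
    unfolding of_real_sum complex_norm_square sum.distrib[symmetric] sum_subtractf[symmetric]
    by (intro sum.cong refl) (simp add: algebra_simps)
  also have "\<dots> = complex_of_real ((\<Sum>i<d. \<Sum>k<d. (cmod (Y i k))\<^sup>2) - 2 * q - 2 * (cmod s)\<^sup>2)"
    unfolding YZ ZY ZZ of_real_diff of_real_mult of_real_sum complex_norm_square by simp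
  finally have "(\<Sum>i<d. \<Sum>k<d. (cmod (Y i k - Z i k))\<^sup>2) = (\<Sum>i<d. \<Sum>k<d. (cmod (Y i k))\<^sup>2) - 2 * q - 2 * (cmod s)\<^sup>2"
    by (simp only: of_real_eq_iff)
  moreover have "(\<Sum>i<d. \<Sum>k<d. (cmod (Y i k - Z i k))\<^sup>2) \<ge> 0" by (intro sum_nonneg) simp
  ultimately have "2 * q \<le> (\<Sum>i<d. \<Sum>k<d. (cmod (Y i k))\<^sup>2)"
    using zero_le_power2[of "cmod s"] by linarith
  then show ?thesis by (simp only: q_def w_def)
qed

lemma renyi_entropy_antisym_channel:
  assumes p: "p > 1" and \<psi>: "\<psi> \<in> carrier_vec (d choose 2)" "\<psi> \<bullet>c \<psi> = 1"
  shows "renyi_entropy p (antisym_channel d (ket_bra \<psi>)) \<ge> 1"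
proof -
  define y where "y = antisym_isometry d *\<^sub>v \<psi>"
  define Y where "Y i k = y $ (i * d + k)" for i k
  have "y \<in> antisym_space d"
    using antisym_isometry_range[of d] \<psi>(1) unfolding y_def by blast
  then have anti: "Y k i = - Y i k" if "i < d" "k < d" for i k
    using that unfolding antisym_space_iff Y_def by blast
  have norm: "(\<Sum>i<d. \<Sum>k<d. (cmod (Y i k))\<^sup>2) = 1"
    using isometry_preserves_norm[OF antisym_isometry_carrier antisym_isometry_isometry \<psi>(1)] unit_vector_norm[OF \<psi>]
    unfolding sum_lessThan_mult Y_def y_def by simp
  obtain u f where u: "\<And>j. j < d \<Longrightarrow> (\<Sum>k<d. (cmod (u j k))\<^sup>2) = 1"
    and f: "\<And>j. j < d \<Longrightarrow> f j = (\<Sum>i<d. (cmod (\<Sum>k<d. Y i k * u j k))\<^sup>2)"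
    and tr: "(\<Sum>j<d. f j) = (\<Sum>i<d. \<Sum>k<d. (cmod (Y i k))\<^sup>2)"
    and S: "renyi_entropy p (gram_mat d {..<d} Y) = 1 / (1 - p) * log 2 (\<Sum>j<d. f j powr p)"
    by (rule gram_mat_spectrum[where n = d and I = "{..<d}" and Y = Y and p = p]) blast
  have f0: "f j \<ge> 0" if "j < d" for j using f[OF that] by (simp add: sum_nonneg)
  have fhalf: "f j \<le> 1 / 2" if "j < d" for j
    using antisymmetric_norm_bound[of d Y "u j", OF anti u[OF that]] unfolding f[OF that] norm by simp
  let ?x = "\<Sum>j<d. f j powr p"
  \<comment> \<open>One factor \<open>f j\<close> is kept, since these factors sum to the trace 1;
    the remaining power p - 1 is bounded through the eigenvalue bound 1/2.\<close>
  have "f j powr p \<le> f j * (1 / 2) powr (p - 1)" if "j < d" for j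
  proof -
    have "f j powr p = f j * f j powr (p - 1)"
      using f0[OF that] p by (cases "f j = 0") (auto simp: powr_diff)
    then show ?thesis
      using powr_mono2[of "p - 1" "f j" "1 / 2"] f0[OF that] fhalf[OF that] p by (simp add: mult_left_mono)
  qed
  then have "?x \<le> (\<Sum>j<d. f j * (1 / 2) powr (p - 1))" by (intro sum_mono) auto
  also have "\<dots> = (1 / 2) powr (p - 1)"
    using tr norm by (simp add: sum_distrib_right[symmetric])
  also have "\<dots> = 2 powr (1 - p)" by (simp add: powr_divide powr_diff)
  finally have le: "?x \<le> 2 powr (1 - p)" .
  \<comment> \<open>Monotonicity of \<open>log\<close> requires a positive moment; trace 1 forces
    some eigenvalue to be positive.\<close>
  have "\<exists>j<d. f j > 0"
  proof (rule ccontr)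
    assume "\<not> ?thesis"
    then have "(\<Sum>j<d. f j) \<le> 0" by (intro sum_nonpos) force
    with tr norm show False by simp
  qed
  then obtain j where "j < d" "f j > 0" by blast
  then have pos: "?x > 0" by (intro sum_pos2[of _ j]) auto
  have "log 2 ?x \<le> log 2 (2 powr (1 - p))"
    by (rule iffD2[OF log_le_cancel_iff]) (use le pos in auto)
  then have "log 2 ?x \<le> 1 - p" by simp
  then have "renyi_entropy p (gram_mat d {..<d} Y) \<ge> 1"
    unfolding S using p by (simp add: field_simps)
  moreover have "antisym_channel d (ket_bra \<psi>) = gram_mat d {..<d} Y"
    unfolding antisym_channel_ket_bra[OF \<psi>(1)] Y_def y_def ..
  ultimately show ?thesis by simp
qed

text \<open>A common lower bound passes to a real \<open>Inf\<close> only over a nonempty set;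
  \<open>d \<ge> 2\<close> makes the input space nonzero and so provides a unit vector.\<close>

lemma min_output_renyi_antisym_channel:
  assumes "p > 1" "d \<ge> 2"
  shows "min_output_renyi p (d choose 2) (antisym_channel d) \<ge> 1"
  unfolding min_output_renyi_def
proof (rule cInf_greatest)
  have "d choose 2 > 0" using assms by (simp add: zero_less_binomial)
  then have "unit_vec (d choose 2) 0 \<bullet>c unit_vec (d choose 2) 0 = (1 :: complex)"
    by (subst scalar_prod_left_unit[of _ "d choose 2"]) auto
  then have "renyi_entropy p (antisym_channel d (ket_bra (unit_vec (d choose 2) 0))) \<in>
      {renyi_entropy p (antisym_channel d (ket_bra \<psi>)) |\<psi>.
        \<psi> \<in> carrier_vec (d choose 2) \<and> \<psi> \<bullet>c \<psi> = 1}"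
    unfolding mem_Collect_eq by (intro exI[of _ "unit_vec (d choose 2) 0"] conjI refl unit_vec_carrier)
  then show "{renyi_entropy p (antisym_channel d (ket_bra \<psi>)) |\<psi>.
      \<psi> \<in> carrier_vec (d choose 2) \<and> \<psi> \<bullet>c \<psi> = 1} \<noteq> {}"
    by (metis empty_iff)
next
  fix x assume "x \<in> {renyi_entropy p (antisym_channel d (ket_bra \<psi>)) |\<psi>.
      \<psi> \<in> carrier_vec (d choose 2) \<and> \<psi> \<bullet>c \<psi> = 1}"
  then show "1 \<le> x" using renyi_entropy_antisym_channel[OF assms(1)] by auto
qed

subsection \<open>Two copies of the channel\<close>

text \<open>\<open>tensor_map\<close> sees a channel only through its values on matrix units, most
  of which are not of the form \<open>ket_bra \<psi>\<close>.\<close>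

lemma antisym_channel_matrix_unit:
  assumes "a < d choose 2" "b < d choose 2" "k < d" "l < d"
  shows "antisym_channel d (matrix_unit (d choose 2) a b) $$ (k, l) =
    (\<Sum>i<d. antisym_isometry d $$ (i * d + k, a) * cnj (antisym_isometry d $$ (i * d + l, b)))"
proof -
  let ?W = "antisym_isometry d" and ?N = "d choose 2"
  have "matrix_unit ?N a b \<in> carrier_mat ?N ?N" by (simp add: matrix_unit_def)
  then have "antisym_channel d (matrix_unit ?N a b) $$ (k, l) = (\<Sum>i<d. \<Sum>a'<?N. \<Sum>b'<?N.
      ?W $$ (i * d + k, a') * matrix_unit ?N a b $$ (a', b') * cnj (?W $$ (i * d + l, b')))"
    using assms(3,4) by (rule antisym_channel_index)
  also have "\<dots> = (\<Sum>i<d. \<Sum>a'<?N. \<Sum>b'<?N.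
      if b' = b then if a' = a then ?W $$ (i * d + k, a) * cnj (?W $$ (i * d + l, b)) else 0 else 0)"
    by (intro sum.cong refl) (auto simp: matrix_unit_def)
  also have "\<dots> = (\<Sum>i<d. ?W $$ (i * d + k, a) * cnj (?W $$ (i * d + l, b)))"
    using assms by simp
  finally show ?thesis .
qed

text \<open>The coefficient of \<open>e\<^sub>m \<otimes> e\<^sub>m' \<otimes> e\<^sub>r\<close>, with \<open>r\<close> indexing the output space, in \<open>(W \<otimes> W) \<psi>\<close>.\<close>

definition antisym_pair_coeff :: "nat \<Rightarrow> complex vec \<Rightarrow> nat \<times> nat \<Rightarrow> nat \<Rightarrow> complex" where
  "antisym_pair_coeff d \<psi> = (\<lambda>(m, m') r. \<Sum>i<d choose 2. \<Sum>k<d choose 2. \<psi> $ (i * (d choose 2) + k) *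
     (antisym_isometry d $$ (m * d + r div d, i) * antisym_isometry d $$ (m' * d + r mod d, k)))"

lemma div_mod_less: "r < d * d \<Longrightarrow> r div d < d \<and> r mod d < (d::nat)"
  by (cases "d = 0") (auto simp: less_mult_imp_div_less)

text \<open>The two traced-out indices \<open>m\<close>, \<open>m'\<close> jointly index the Gram
  family. For each such pair the summand splits into a factor in the row indices \<open>i\<close>,
  \<open>k\<close> and a conjugated factor in the column indices \<open>j\<close>,
  \<open>l\<close>.\<close>

lemma tensor_antisym_channel_ket_bra:
  assumes \<psi>: "\<psi> \<in> carrier_vec ((d choose 2) * (d choose 2))"
  shows "tensor_map (d choose 2) d (d choose 2) d (antisym_channel d) (antisym_channel d) (ket_bra \<psi>) =
    gram_mat (d * d) ({..<d} \<times> {..<d}) (antisym_pair_coeff d \<psi>)"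
proof -
  define N where "N = d choose 2"
  define W where "W = antisym_isometry d"
  define F where "F m m' r i k = \<psi> $ (i * N + k) * (W $$ (m * d + r div d, i) * W $$ (m' * d + r mod d, k))" for m m' r i k
  have coeff: "antisym_pair_coeff d \<psi> (m, m') r = (\<Sum>i<N. \<Sum>k<N. F m m' r i k)" for m m' r
    by (simp add: antisym_pair_coeff_def F_def N_def W_def)
  have entry: "ket_bra \<psi> $$ (i * N + k, j * N + l) *
      kronecker (antisym_channel d (matrix_unit N i j)) (antisym_channel d (matrix_unit N k l)) $$ (r, s)
      = (\<Sum>m<d. \<Sum>m'<d. F m m' r i k * cnj (F m m' s j l))"
    if rs: "r < d * d" "s < d * d" and b: "i < N" "j < N" "k < N" "l < N" for r s i j k l
  proof -
    note dm = div_mod_less[OF rs(1)] div_mod_less[OF rs(2)]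
    have kr: "kronecker (antisym_channel d (matrix_unit N i j)) (antisym_channel d (matrix_unit N k l)) $$ (r, s) =
        (\<Sum>m<d. W $$ (m * d + r div d, i) * cnj (W $$ (m * d + s div d, j))) *
        (\<Sum>m'<d. W $$ (m' * d + r mod d, k) * cnj (W $$ (m' * d + s mod d, l)))"
      using rs b dm unfolding N_def W_def by (simp add: kronecker_def antisym_channel_matrix_unit)
    have kb: "ket_bra \<psi> $$ (i * N + k, j * N + l) = \<psi> $ (i * N + k) * cnj (\<psi> $ (j * N + l))"
      using \<psi> b by (simp add: ket_bra_def N_def pair_index_less)
    show ?thesis
      unfolding kr kb sum_product unfolding F_def complex_cnj_mult sum_distrib_left
      by (intro sum.cong refl) (simp only: mult_ac)
  qed
  show ?thesis
    unfolding N_def[symmetric]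
  proof (rule eq_matI)
    fix r s assume "r < dim_row (gram_mat (d * d) ({..<d} \<times> {..<d}) (antisym_pair_coeff d \<psi>))"
      "s < dim_col (gram_mat (d * d) ({..<d} \<times> {..<d}) (antisym_pair_coeff d \<psi>))"
    then have rs: "r < d * d" "s < d * d" by auto
    have "tensor_map N d N d (antisym_channel d) (antisym_channel d) (ket_bra \<psi>) $$ (r, s) =
        (\<Sum>i<N. \<Sum>j<N. \<Sum>k<N. \<Sum>l<N. \<Sum>m<d. \<Sum>m'<d. F m m' r i k * cnj (F m m' s j l))"
      unfolding tensor_map_def using rs by (simp add: entry[OF rs])
    also have "\<dots> = (\<Sum>m<d. \<Sum>m'<d. \<Sum>i<N. \<Sum>j<N. \<Sum>k<N. \<Sum>l<N. F m m' r i k * cnj (F m m' s j l))"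
      unfolding sum.swap[of _ "{..<d}" "{..<N}"] ..
    also have "\<dots> = (\<Sum>m<d. \<Sum>m'<d. (\<Sum>i<N. \<Sum>k<N. F m m' r i k) * cnj (\<Sum>j<N. \<Sum>l<N. F m m' s j l))"
      unfolding cnj_sum sum_product ..
    also have "\<dots> = gram_mat (d * d) ({..<d} \<times> {..<d}) (antisym_pair_coeff d \<psi>) $$ (r, s)"
      unfolding gram_mat_index[OF rs] coeff[symmetric]
      by (simp only: sum.cartesian_product split_def prod.collapse)
    finally show "tensor_map N d N d (antisym_channel d) (antisym_channel d) (ket_bra \<psi>) $$ (r, s) =
      gram_mat (d * d) ({..<d} \<times> {..<d}) (antisym_pair_coeff d \<psi>) $$ (r, s)" .
  qed (simp_all add: tensor_map_def)
qed

section \<open>Boundedness below of the two-copy output entropies\<close>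

text \<open>A deliberately crude bound, depending on the family only through \<open>C\<close>:
  nonnegative eigenvalues are each at most their sum, the trace.\<close>

lemma renyi_entropy_gram_mat_lower:
  assumes p: "p > 1" and C: "(\<Sum>i\<in>I. \<Sum>k<n. (cmod (Y i k))\<^sup>2) \<le> C"
  shows "renyi_entropy p (gram_mat n I Y) \<ge> 1 / (1 - p) * log 2 (1 + real n * C powr p)"
proof -
  obtain u f where f: "\<And>j. j < n \<Longrightarrow> f j = (\<Sum>i\<in>I. (cmod (\<Sum>k<n. Y i k * u j k))\<^sup>2)"
    and tr: "(\<Sum>j<n. f j) = (\<Sum>i\<in>I. \<Sum>k<n. (cmod (Y i k))\<^sup>2)"
    and S: "renyi_entropy p (gram_mat n I Y) = 1 / (1 - p) * log 2 (\<Sum>j<n. f j powr p)"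
    by (rule gram_mat_spectrum[where n = n and I = I and Y = Y and p = p]) blast
  have f0: "f j \<ge> 0" if "j < n" for j using f[OF that] by (simp add: sum_nonneg)
  have fC: "f j \<le> C" if "j < n" for j
    using member_le_sum[of j "{..<n}" f] f0 that tr C by auto
  let ?x = "\<Sum>j<n. f j powr p" and ?K = "1 + real n * C powr p"
  have "?x \<le> (\<Sum>j<n. C powr p)" using f0 fC p by (intro sum_mono powr_mono2) auto
  then have xK: "?x \<le> ?K" by simp
  have "log 2 ?x \<le> log 2 ?K"
  proof (cases "?x = 0")
    case False
    then have "?x > 0" using sum_nonneg[of "{..<n}" "\<lambda>j. f j powr p"] by simp
    then show ?thesis using xK by simp
  next
    \<comment> \<open>Here \<open>log 2 0\<close> is 0 by convention; the summand 1 in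
      \<open>?K\<close> keeps \<open>log 2 ?K\<close> nonnegative and so covers this case.\<close>
    case True
    have "?K \<ge> 1" by simp
    then show ?thesis unfolding True by (simp add: log_def)
  qed
  then show ?thesis unfolding S using p by (simp add: divide_right_mono_neg)
qed

lemma norm_antisym_isometry_le_1:
  assumes "r < d * d" "c < d choose 2"
  shows "cmod (antisym_isometry d $$ (r, c)) \<le> 1"
  using assms by (auto simp: antisym_isometry_def norm_divide split: prod.splits)

text \<open>A real \<open>Inf\<close> lies below the members of its set only if the set is bounded
  below; this is what lets one good input bound the two-copy minimum from above.\<close>

lemma bdd_below_tensor_antisym_channel:
  assumes p: "p > 1"
  shows "bdd_below {renyi_entropy p (tensor_map (d choose 2) d (d choose 2) d (antisym_channel d) (antisym_channel d)
    (ket_bra \<psi>)) | \<psi>. \<psi> \<in> carrier_vec ((d choose 2) * (d choose 2)) \<and> \<psi> \<bullet>c \<psi> = 1}"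
proof -
  define N where "N = d choose 2"
  \<comment> \<open>There are d * d pairs of traced-out indices and d * d output indices, and each
    coefficient is a sum of N * N terms of modulus at most 1.\<close>
  define C where "C = real (d * d) * (real (d * d) * (real (N * N))\<^sup>2)"
  have "renyi_entropy p (tensor_map N d N d (antisym_channel d) (antisym_channel d) (ket_bra \<psi>))
      \<ge> 1 / (1 - p) * log 2 (1 + real (d * d) * C powr p)"
    if \<psi>: "\<psi> \<in> carrier_vec (N * N)" "\<psi> \<bullet>c \<psi> = 1" for \<psi>
    unfolding N_def tensor_antisym_channel_ket_bra[OF \<psi>(1)[unfolded N_def]]
  proof (rule renyi_entropy_gram_mat_lower[OF p])
    have le1: "cmod (\<psi> $ i) \<le> 1" if "i < N * N" for i
    proof -
      have "(cmod (\<psi> $ i))\<^sup>2 \<le> (\<Sum>k<N * N. (cmod (\<psi> $ k))\<^sup>2)"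
        using that by (intro member_le_sum) auto
      then show ?thesis unfolding unit_vector_norm[OF \<psi>] by (simp add: power_le_one_iff)
    qed
    have "cmod (antisym_pair_coeff d \<psi> x r) \<le> real (N * N)" if x: "x \<in> {..<d} \<times> {..<d}" and r: "r < d * d" for x r
    proof -
      obtain m m' where m: "x = (m, m')" "m < d" "m' < d" using x by auto
      have "cmod (antisym_pair_coeff d \<psi> x r) \<le> (\<Sum>i<N. \<Sum>k<N. cmod (\<psi> $ (i * N + k) *
          (antisym_isometry d $$ (m * d + r div d, i) * antisym_isometry d $$ (m' * d + r mod d, k))))"
        unfolding antisym_pair_coeff_def m(1) prod.case N_def[symmetric]
        by (intro order.trans[OF norm_sum] sum_mono norm_sum)
      also have "\<dots> \<le> (\<Sum>i<N. \<Sum>k<N. 1)"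
        using div_mod_less[OF r] m unfolding norm_mult
        by (intro sum_mono mult_le_one mult_nonneg_nonneg norm_ge_zero le1 norm_antisym_isometry_le_1)
          (auto simp: pair_index_less N_def)
      finally show ?thesis by simp
    qed
    then have "(\<Sum>x\<in>{..<d} \<times> {..<d}. \<Sum>r<d * d. (cmod (antisym_pair_coeff d \<psi> x r))\<^sup>2)
        \<le> (\<Sum>x\<in>{..<d} \<times> {..<d}. \<Sum>r<d * d. (real (N * N))\<^sup>2)"
      by (intro sum_mono power_mono) auto
    then show "(\<Sum>x\<in>{..<d} \<times> {..<d}. \<Sum>r<d * d. (cmod (antisym_pair_coeff d \<psi> x r))\<^sup>2) \<le> C"
      by (simp add: C_def card_cartesian_product)
  qed
  then show ?thesis unfolding N_def[symmetric] by (intro bdd_belowI) auto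
qed

text \<open>\<open>antisym_isometry\<close> has real entries, so the sum is an entry of the isometry
  times its adjoint. That product is the projection (1 - V) / 2 onto the antisymmetric subspace,
  where V is the swap.\<close>

lemma antisym_isometry_projection:
  assumes "a < d" "b < d" "a' < d" "b' < d"
  shows "(\<Sum>c<d choose 2. antisym_isometry d $$ (a * d + b, c) * antisym_isometry d $$ (a' * d + b', c)) =
    ((if a = a' \<and> b = b' then 1 else 0) - (if a = b' \<and> b = a' then 1 else 0)) / 2"
proof -
  define s where "s = complex_of_real (1 / sqrt 2)"
  have s: "s * s = 1 / 2" unfolding s_def by (rule half_sq)
  define h where "h a b x = (if x = (a, b) then s else if x = (b, a) then - s else 0)" for a b :: nat and x
  have entry: "antisym_isometry d $$ (a * d + b, c) = h a b (antisym_pairs d ! c)"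
    if "a < d" "b < d" "c < d choose 2" for a b c
    unfolding antisym_isometry_entry[OF that] h_def s_def by (rule refl)
  \<comment> \<open>On a diagonal pair with x = y = a' = b' the left side would be 1/2 and the right
    side 0. Pairs in \<open>S\<close> are never diagonal.\<close>
  have sh: "s * h a' b' (x, y) = ((if x = a' \<and> y = b' then 1 else 0) - (if x = b' \<and> y = a' then 1 else 0)) / 2"
    if "x \<noteq> y" for x y
  proof -
    consider "x = a' \<and> y = b'" | "x = b' \<and> y = a'" | "\<not> (x = a' \<and> y = b')" "\<not> (x = b' \<and> y = a')" by blast
    then show ?thesis using that by cases (simp_all add: h_def s, auto)
  qed
  define S where "S = {(i, j). i < j \<and> j < d}"
  have S: "finite S" unfolding S_def set_antisym_pairs[symmetric] by simp
  have pairs: "(\<Sum>c<d choose 2. g (antisym_pairs d ! c)) = (\<Sum>x\<in>S. g x)" for g :: "nat \<times> nat \<Rightarrow> complex"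
  proof (rule sum.reindex_bij_betw)
    show "bij_betw ((!) (antisym_pairs d)) {..<d choose 2} S"
      by (rule bij_betw_nth) (simp_all add: distinct_antisym_pairs set_antisym_pairs S_def)
  qed
  have "(\<Sum>c<d choose 2. antisym_isometry d $$ (a * d + b, c) * antisym_isometry d $$ (a' * d + b', c))
      = (\<Sum>x\<in>S. h a b x * h a' b' x)"
    unfolding pairs[of "\<lambda>x. h a b x * h a' b' x", symmetric] by (intro sum.cong refl) (simp only: entry assms lessThan_iff)
  also have "\<dots> = ((if a = a' \<and> b = b' then 1 else 0) - (if a = b' \<and> b = a' then 1 else 0)) / 2"
  proof (cases a b rule: linorder_cases)
    case less
    have "h a b x = (if x = (a, b) then s else 0)" if "x \<in> S" for x
      using that less by (auto simp: h_def S_def)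
    then have "(\<Sum>x\<in>S. h a b x * h a' b' x) = (\<Sum>x\<in>S. if x = (a, b) then s * h a' b' (a, b) else 0)"
      by (intro sum.cong) simp_all
    also have "\<dots> = s * h a' b' (a, b)" using S less assms by (simp add: S_def)
    finally show ?thesis using sh[of a b] less by simp
  next
    case equal
    have "h a b x = 0" if "x \<in> S" for x
      using that unfolding equal by (auto simp: h_def S_def)
    then have "(\<Sum>x\<in>S. h a b x * h a' b' x) = 0" by (intro sum.neutral) simp
    moreover have "(a = a' \<and> b = b') = (a = b' \<and> b = a')" unfolding equal by (rule conj_commute)
    ultimately show ?thesis by simp
  next
    case greater
    have "h a b x = (if x = (b, a) then - s else 0)" if "x \<in> S" for x
      using that greater by (auto simp: h_def S_def)
    then have "(\<Sum>x\<in>S. h a b x * h a' b' x) = (\<Sum>x\<in>S. if x = (b, a) then - s * h a' b' (b, a) else 0)"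
      by (intro sum.cong) simp_all
    also have "\<dots> = - s * h a' b' (b, a)" using S greater assms by (simp add: S_def)
    finally show ?thesis using sh[of b a] greater by (simp add: conj_commute)
  qed
  finally show ?thesis .
qed

subsection \<open>The maximally entangled input\<close>

text \<open>The entanglement is between the inputs of the two copies, so the definition is used with
  \<open>n = d choose 2\<close>, in the basis that indexes the columns of
  \<open>antisym_isometry\<close>.\<close>

definition max_entangled :: "nat \<Rightarrow> complex vec" where
  "max_entangled n = Matrix.vec (n * n) (\<lambda>r. if r div n = r mod n then complex_of_real (1 / sqrt n) else 0)"

lemma max_entangled_carrier [simp]: "max_entangled n \<in> carrier_vec (n * n)"
  by (simp add: max_entangled_def)

lemma max_entangled_index:
  "i < n \<Longrightarrow> k < n \<Longrightarrow> max_entangled n $ (i * n + k) = (if i = k then complex_of_real (1 / sqrt n) else 0)"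
  by (simp add: max_entangled_def pair_index_less)

lemma max_entangled_norm:
  assumes "n > 0"
  shows "max_entangled n \<bullet>c max_entangled n = 1"
proof -
  have "(\<Sum>r<n * n. (cmod (max_entangled n $ r))\<^sup>2) = (\<Sum>i<n. \<Sum>k<n. if k = i then 1 / real n else 0)"
    unfolding sum_lessThan_mult
    by (intro sum.cong refl) (auto simp: max_entangled_index norm_divide power_divide)
  also have "\<dots> = 1" using assms by simp
  finally show ?thesis by (simp add: cscalar_prod_self[OF max_entangled_carrier])
qed

text \<open>The input pairs equal basis vectors of the two copies, so the coefficient is an entry of
  the projection (1 - V) / 2, with row index (m, a) from the first copy and column index (m', b)
  from the second. The input amplitude and the 1/2 of the projection make up the prefactor.\<close>

lemma antisym_pair_coeff_max_entangled:
  assumes "m < d" "m' < d" "a < d" "b < d"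
  shows "antisym_pair_coeff d (max_entangled (d choose 2)) (m, m') (a * d + b) =
    complex_of_real (1 / (2 * sqrt (d choose 2))) *
    ((if m = m' \<and> a = b then 1 else 0) - (if m = b \<and> a = m' then 1 else 0))"
proof -
  define N where "N = d choose 2"
  let ?W = "antisym_isometry d" and ?t = "complex_of_real (1 / sqrt N)"
  have ab: "(a * d + b) div d = a" "(a * d + b) mod d = b" using assms by auto
  have "antisym_pair_coeff d (max_entangled N) (m, m') (a * d + b) =
      (\<Sum>i<N. \<Sum>k<N. if k = i then ?t * (?W $$ (m * d + a, i) * ?W $$ (m' * d + b, i)) else 0)"
    unfolding antisym_pair_coeff_def prod.case N_def[symmetric] ab
    by (intro sum.cong refl) (auto simp: max_entangled_index)
  also have "\<dots> = ?t * (\<Sum>i<N. ?W $$ (m * d + a, i) * ?W $$ (m' * d + b, i))"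
    by (simp add: sum_distrib_left)
  also have "\<dots> = ?t * (((if m = m' \<and> a = b then 1 else 0) - (if m = b \<and> a = m' then 1 else 0)) / 2)"
    unfolding N_def antisym_isometry_projection[OF assms(1,3,2,4)] ..
  also have "?t * (x / 2) = complex_of_real (1 / (2 * sqrt N)) * x" for x
    by simp
  finally show ?thesis unfolding N_def .
qed

lemma gram_mat_mult_vec:
  assumes "v \<in> carrier_vec n" "r < n"
  shows "(gram_mat n I Y *\<^sub>v v) $ r = (\<Sum>i\<in>I. Y i r * (\<Sum>s<n. cnj (Y i s) * v $ s))"
proof -
  have "(gram_mat n I Y *\<^sub>v v) $ r = (\<Sum>s<n. \<Sum>i\<in>I. Y i r * (cnj (Y i s) * v $ s))"
    unfolding mult_mat_vec_index_sum[OF gram_mat_carrier assms]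
    using assms(2) by (intro sum.cong refl) (simp add: gram_mat_index sum_distrib_right mult.assoc)
  then show ?thesis unfolding sum_distrib_left by (subst sum.swap)
qed

text \<open>
  The output is the isotropic state \<open>((d - 2) d \<Phi> + 1) / (2 d (d - 1))\<close>, where \<open>\<Phi>\<close> projects onto the maximally
  entangled vector; only its top eigenvalue is needed.
\<close>

lemma gram_mat_max_entangled_eigenvector:
  assumes d: "d \<ge> 2"
  defines "v \<equiv> Matrix.vec (d * d) (\<lambda>r. if r div d = r mod d then 1 else 0)"
  shows "gram_mat (d * d) ({..<d} \<times> {..<d}) (antisym_pair_coeff d (max_entangled (d choose 2))) *\<^sub>v v =
    complex_of_real (real (d - 1) / real (2 * d)) \<cdot>\<^sub>v v"
proof (rule eq_vecI)
  define Y where "Y = antisym_pair_coeff d (max_entangled (d choose 2))"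
  define \<kappa> where "\<kappa> = complex_of_real (1 / (2 * sqrt (d choose 2)))"
  have Y: "Y (m, m') (a * d + b) = \<kappa> * ((if m = m' \<and> a = b then 1 else 0) - (if m = b \<and> a = m' then 1 else 0))"
    if "m < d" "m' < d" "a < d" "b < d" for m m' a b
    unfolding Y_def \<kappa>_def by (rule antisym_pair_coeff_max_entangled[OF that])
  have v: "v \<in> carrier_vec (d * d)" by (simp add: v_def)
  have vi: "v $ (a * d + b) = (if a = b then 1 else 0)" if "a < d" "b < d" for a b
    using that by (simp add: v_def pair_index_less)
  have one: "of_nat d - 1 = (of_nat (d - 1) :: complex)" using d by (simp add: of_nat_diff)
  have e1: "real (d choose 2) = real d * real (d - 1) / 2"
    unfolding choose_two using d by (subst real_of_nat_div) auto
  have e2: "(1 / (2 * sqrt (d choose 2))) * (1 / (2 * sqrt (d choose 2))) = 1 / (4 * real (d choose 2))"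
    by simp
  have e3: "1 / (4 * (x * y / 2)) * (y * y) = y / (2 * x)" if "y > 0" for x y :: real
    using that by (cases "x = 0") (simp_all add: field_simps)
  have "(1 / (2 * sqrt (d choose 2))) * (1 / (2 * sqrt (d choose 2))) * (real (d - 1) * real (d - 1))
      = real (d - 1) / real (2 * d)"
    unfolding e2 unfolding e1 of_nat_mult of_nat_numeral by (rule e3) (use d in simp)
  then have "complex_of_real ((1 / (2 * sqrt (d choose 2))) * (1 / (2 * sqrt (d choose 2))) * (real (d - 1) * real (d - 1)))
      = complex_of_real (real (d - 1) / real (2 * d))"
    by (rule arg_cong)
  then have \<kappa>: "\<kappa> * cnj \<kappa> * (of_nat (d - 1) * of_nat (d - 1)) = complex_of_real (real (d - 1) / real (2 * d))"
    unfolding \<kappa>_def complex_cnj_complex_of_real by (simp only: of_real_mult of_real_of_nat_eq)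
  \<comment> \<open>Only output indices with a = b meet \<open>v\<close>. If m = m', the two
    indicators cancel at a = m and leave d - 1 terms; otherwise both vanish.\<close>
  have inner: "(\<Sum>s<d * d. cnj (Y (m, m') s) * v $ s) = (if m = m' then cnj \<kappa> * of_nat (d - 1) else 0)"
    if m: "m < d" "m' < d" for m m'
  proof -
    have "(\<Sum>s<d * d. cnj (Y (m, m') s) * v $ s) = (\<Sum>a<d. \<Sum>b<d. if b = a then cnj (Y (m, m') (a * d + a)) else 0)"
      unfolding sum_lessThan_mult by (intro sum.cong refl) (simp add: vi)
    also have "\<dots> = (\<Sum>a<d. cnj \<kappa> * ((if m = m' then 1 else 0) - (if a = m then if m = m' then 1 else 0 else 0)))"
      by (intro sum.cong refl) (use m in \<open>auto simp: Y\<close>)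
    also have "\<dots> = cnj \<kappa> * (\<Sum>a<d. (if m = m' then 1 else 0) - (if a = m then if m = m' then 1 else 0 else 0))"
      by (simp only: sum_distrib_left)
    also have "\<dots> = (if m = m' then cnj \<kappa> * of_nat (d - 1) else 0)"
      using m unfolding one[symmetric] by (simp add: sum_subtractf)
    finally show ?thesis .
  qed
  fix r assume "r < dim_vec (complex_of_real (real (d - 1) / real (2 * d)) \<cdot>\<^sub>v v)"
  then have r: "r < d * d" by (simp add: v_def)
  define a b where "a = r div d" and "b = r mod d"
  have ab: "a < d" "b < d" "r = a * d + b" using div_mod_less[OF r] by (simp_all add: a_def b_def)
  have "(gram_mat (d * d) ({..<d} \<times> {..<d}) Y *\<^sub>v v) $ r =
      (\<Sum>m<d. \<Sum>m'<d. Y (m, m') r * (if m = m' then cnj \<kappa> * of_nat (d - 1) else 0))"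
    unfolding gram_mat_mult_vec[OF v r] sum.cartesian_product by (intro sum.cong refl) (auto simp: inner)
  also have "\<dots> = (\<Sum>m<d. \<Sum>m'<d. if m' = m then Y (m, m) r * (cnj \<kappa> * of_nat (d - 1)) else 0)"
    by (intro sum.cong refl) auto
  also have "\<dots> = (\<Sum>m<d. \<kappa> * ((if a = b then 1 else 0) - (if m = a then if a = b then 1 else 0 else 0)) * (cnj \<kappa> * of_nat (d - 1)))"
    by (intro sum.cong refl) (use ab in \<open>auto simp: Y\<close>)
  also have "\<dots> = \<kappa> * (\<Sum>m<d. (if a = b then 1 else 0) - (if m = a then if a = b then 1 else 0 else 0)) * (cnj \<kappa> * of_nat (d - 1))"
    by (simp only: sum_distrib_left sum_distrib_right)
  also have "\<dots> = (if a = b then \<kappa> * cnj \<kappa> * (of_nat (d - 1) * of_nat (d - 1)) else 0)"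
    using ab unfolding one[symmetric] by (simp add: sum_subtractf)
  also have "\<dots> = (complex_of_real (real (d - 1) / real (2 * d)) \<cdot>\<^sub>v v) $ r"
    unfolding \<kappa> using r vi[OF ab(1,2)] v by (simp add: ab(3))
  finally show "(gram_mat (d * d) ({..<d} \<times> {..<d}) (antisym_pair_coeff d (max_entangled (d choose 2))) *\<^sub>v v) $ r =
    (complex_of_real (real (d - 1) / real (2 * d)) \<cdot>\<^sub>v v) $ r"
    unfolding Y_def .
qed (simp add: v_def)

section \<open>From one large eigenvalue to the strict inequality\<close>

text \<open>The p-th powers of all eigenvalues are nonnegative, so a single one bounds the moment
  from below; the negative factor 1 / (1 - p) reverses the comparison.\<close>

lemma renyi_entropy_gram_mat_less:
  assumes p: "p > 1" and v: "v \<in> carrier_vec n" "v \<noteq> 0\<^sub>v n"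
    and eig: "gram_mat n I Y *\<^sub>v v = complex_of_real c \<cdot>\<^sub>v v" and c: "c powr p > x" "x > 0"
  shows "renyi_entropy p (gram_mat n I Y) < 1 / (1 - p) * log 2 x"
proof -
  obtain f where e: "\<exists>j<n. f j = c"
    and S: "renyi_entropy p (gram_mat n I Y) = 1 / (1 - p) * log 2 (\<Sum>j<n. f j powr p)"
    by (rule gram_mat_spectrum[where n = n and I = I and Y = Y and p = p]) (use v eig in blast)
  obtain j where j: "j < n" "f j = c" using e by blast
  have "f j powr p \<le> (\<Sum>j<n. f j powr p)" using j by (intro member_le_sum) auto
  then have "log 2 x < log 2 (\<Sum>j<n. f j powr p)" using c j(2) by simp
  then show ?thesis unfolding S using p by (intro mult_strict_left_mono_neg) auto
qed

theorem mainTheorem1: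
  fixes p :: real
  assumes "p > 2"
  shows "\<exists>d::nat. d \<ge> 2 \<and>
    min_output_renyi p ((d choose 2) * (d choose 2))
      (tensor_map (d choose 2) d (d choose 2) d (antisym_channel d) (antisym_channel d))
    < 2 * min_output_renyi p (d choose 2) (antisym_channel d)"
proof -
  have p: "p > 1" using assms by simp
  \<comment> \<open>\<open>t\<close> solves (t / 2) powr p = 4 powr (1 - p); it is below 1 because p
    > 2.\<close>
  define t where "t = (2::real) powr ((2 - p) / p)"
  have "t < 2 powr 0" unfolding t_def using assms by (intro powr_less_mono) (auto simp: divide_neg_pos)
  then have t: "t < 1" "t > 0" by (simp_all add: t_def)
  obtain d0 :: nat where d0: "1 / (1 - t) < real d0" using reals_Archimedean2 by blast
  \<comment> \<open>Beyond 1 / (1 - t) one has 1 - 1 / d > t, which puts the eigenvalue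
    \<open>c\<close> above t / 2.\<close>
  define d where "d = max 2 d0"
  have d: "d \<ge> 2" and "1 / (1 - t) < real d" using d0 by (auto simp: d_def)
  then have "1 / real d < 1 - t" using t by (simp add: field_simps)
  define c where "c = real (d - 1) / real (2 * d)"
  have "c = (1 - 1 / real d) / 2" using d by (simp add: c_def of_nat_diff field_simps)
  with \<open>1 / real d < 1 - t\<close> have "t / 2 < c" by simp
  then have "(t / 2) powr p < c powr p" using t p by (intro powr_less_mono2) auto
  moreover have "(t / 2) powr p = 2 powr (2 * (1 - p))"
    using p t by (simp add: t_def powr_divide powr_powr flip: powr_diff)
  ultimately have c: "2 powr (2 * (1 - p)) < c powr p" by simp
  define v :: "complex vec" where "v = Matrix.vec (d * d) (\<lambda>r. if r div d = r mod d then 1 else 0)"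
  have v: "v \<in> carrier_vec (d * d)" by (simp add: v_def)
  have "v $ 0 = 1" using d by (simp add: v_def)
  then have v0: "v \<noteq> 0\<^sub>v (d * d)" using d by auto
  let ?\<Lambda> = "tensor_map (d choose 2) d (d choose 2) d (antisym_channel d) (antisym_channel d)"
    and ?\<psi> = "max_entangled (d choose 2)"
  have "renyi_entropy p (?\<Lambda> (ket_bra ?\<psi>)) < 1 / (1 - p) * log 2 (2 powr (2 * (1 - p)))"
    unfolding tensor_antisym_channel_ket_bra[OF max_entangled_carrier]
    by (rule renyi_entropy_gram_mat_less[OF p v v0 _ c])
      (use gram_mat_max_entangled_eigenvector[OF d] in \<open>simp_all add: v_def c_def\<close>)
  \<comment> \<open>The threshold 4 powr (1 - p) is exactly the moment of entropy 2, twice the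
    one-copy lower bound.\<close>
  also have "\<dots> = 2" using p by (simp add: field_simps)
  finally have less: "renyi_entropy p (?\<Lambda> (ket_bra ?\<psi>)) < 2" .
  have "d choose 2 > 0" using d by (simp add: zero_less_binomial)
  then have "renyi_entropy p (?\<Lambda> (ket_bra ?\<psi>)) \<in> {renyi_entropy p (?\<Lambda> (ket_bra \<psi>)) |\<psi>.
      \<psi> \<in> carrier_vec ((d choose 2) * (d choose 2)) \<and> \<psi> \<bullet>c \<psi> = 1}"
    unfolding mem_Collect_eq
    by (intro exI[of _ ?\<psi>] conjI refl max_entangled_carrier max_entangled_norm)
  then have "min_output_renyi p ((d choose 2) * (d choose 2)) ?\<Lambda> \<le> renyi_entropy p (?\<Lambda> (ket_bra ?\<psi>))"
    unfolding min_output_renyi_def by (rule cInf_lower[OF _ bdd_below_tensor_antisym_channel[OF p]])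
  then show ?thesis
    using less min_output_renyi_antisym_channel[OF p d] d by (intro exI[of _ d]) linarith
qed

end
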